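(* Let $R$ be a root system in $\mathbb{R}^n$ with multiplicity function $\kappa\ge 0$ and associated Dunkl Laplacian $\Delta_h$. If $f\in C^2(\mathbb{R}^n)$ is a real-valued Dunkl harmonic function on $\mathbb{R}^n$ (i.e. $\Delta_h f=0$ on $\mathbb{R}^n$) which is bounded above or bounded below, then $f$ is constant.
   Context: For a nonzero vector $v\in\mathbb{R}^n$, $\sigma_v x = x-2\frac{\langle x,v\rangle}{|v|^2}v$ is the reflection in the hyperplane orthogonal to $v$, where $\langle\cdot,\cdot\rangle$ is the Euclidean inner product and $|x|^2=\langle x,x\rangle$. A root system $R$ is a finite set of nonzero vectors in $\mathbb{R}^n$ such that $\sigma_v R=R$ and $R\cap\mathbb{R}v=\{\pm v\}$ for all $v\in R$. The Coxeter group $G$ is the subgroup of $O(n)$ generated by $\{\sigma_v: v\in R\}$. A positive subsystem $R_+\subset R$ is a subset such that $R=R_+\cup(-R_+)$, where $R_+$ and $-R_+$ are separated by some hyperplane through the origin; one such $R_+$ is fixed. A multiplicity function is a $G$-invariant function $\kappa:R\to\mathbb{C}$, $v\mapsto\kappa_v$ (i.e. $\kappa_{gv}=\kappa_v$ for all $g\in G$); it is assumed throughout that $\kappa_v\ge 0$ for all $v\in R$. The Dunkl operators are $$\mathcal{D}_jf(x)=\frac{\partial f}{\partial x_j}(x)+\sum_{v\in R_+}\kappa_v\frac{f(x)-f(\sigma_v x)}{\langle x,v\rangle}v_j,\qquad j=1,\dots,n,$$ (the quotient being understood by continuous extension where $\langle x,v\rangle=0$), and the Dunkl Laplacian is $\Delta_h=\sum_{j=1}^n\mathcal{D}_j^2$.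 *)

theory Defs
  imports "HOL-Analysis.Analysis" "HOL-Algebra.Generated_Groups"
begin

definition reflection :: "real^'n \<Rightarrow> real^'n \<Rightarrow> real^'n" where
  "reflection v x = x - (2 * (inner x v / (norm v)^2)) *\<^sub>R v"

definition root_system :: "(real^'n) set \<Rightarrow> bool" where
  "root_system R \<longleftrightarrow> finite R \<and> 0 \<notin> R \<and>
     (\<forall>v\<in>R. reflection v ` R = R \<and> R \<inter> range (\<lambda>c. c *\<^sub>R v) = {v, -v})"

definition orthogonal_group :: "(real^'n \<Rightarrow> real^'n) monoid" where
  "orthogonal_group =
     \<lparr>carrier = {g. orthogonal_transformation g}, mult = (\<circ>), one = id\<rparr>"

definition coxeter_group :: "(real^'n) set \<Rightarrow> (real^'n \<Rightarrow> real^'n) set" where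
  "coxeter_group R = generate orthogonal_group (reflection ` R)"

definition positive_subsystem :: "(real^'n) set \<Rightarrow> (real^'n) set \<Rightarrow> bool" where
  "positive_subsystem R Rp \<longleftrightarrow> Rp \<subseteq> R \<and> R = Rp \<union> uminus ` Rp \<and>
     (\<exists>u. u \<noteq> 0 \<and> (\<forall>v\<in>Rp. inner u v > 0) \<and> (\<forall>v\<in>uminus ` Rp. inner u v < 0))"

text \<open>Multiplicity functions are total here, but only their values on \<open>R\<close> matter. They are
  real-valued because complex ones are only considered when all values are nonnegative reals.\<close>

definition multiplicity_function :: "(real^'n) set \<Rightarrow> (real^'n \<Rightarrow> real) \<Rightarrow> bool" where
  "multiplicity_function R \<kappa> \<longleftrightarrow> (\<forall>g\<in>coxeter_group R. \<forall>v\<in>R. \<kappa> (g v) = \<kappa> v)"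

definition partial_deriv :: "'n \<Rightarrow> (real^'n \<Rightarrow> real) \<Rightarrow> real^'n \<Rightarrow> real" where
  "partial_deriv j f x = deriv (\<lambda>t. f (x + t *\<^sub>R axis j 1)) 0"

definition C1 :: "(real^'n \<Rightarrow> real) \<Rightarrow> bool" where
  "C1 f \<longleftrightarrow> f differentiable_on UNIV \<and> (\<forall>j. continuous_on UNIV (partial_deriv j f))"

definition C2 :: "(real^'n \<Rightarrow> real) \<Rightarrow> bool" where
  "C2 f \<longleftrightarrow> C1 f \<and> (\<forall>j. C1 (partial_deriv j f))"

text \<open>The difference quotient in direction \<open>v\<close>, extended to the hyperplane orthogonal to \<open>v\<close> by
  its limit from the complement. For differentiable \<open>f\<close> with continuous partial derivatives this
  limit exists; otherwise the value on the hyperplane is unspecified.\<close>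

definition dunkl_quotient :: "real^'n \<Rightarrow> (real^'n \<Rightarrow> real) \<Rightarrow> real^'n \<Rightarrow> real" where
  "dunkl_quotient v f x =
     (if inner x v \<noteq> 0 then (f x - f (reflection v x)) / inner x v
      else Lim (at x within {y. inner y v \<noteq> 0})
             (\<lambda>y. (f y - f (reflection v y)) / inner y v))"

definition dunkl_operator ::
    "(real^'n) set \<Rightarrow> (real^'n \<Rightarrow> real) \<Rightarrow> 'n \<Rightarrow> (real^'n \<Rightarrow> real) \<Rightarrow> real^'n \<Rightarrow> real" where
  "dunkl_operator Rp \<kappa> j f x =
     partial_deriv j f x + (\<Sum>v\<in>Rp. \<kappa> v * dunkl_quotient v f x * v $ j)"

definition dunkl_laplacian ::
    "(real^'n) set \<Rightarrow> (real^'n \<Rightarrow> real) \<Rightarrow> (real^'n \<Rightarrow> real) \<Rightarrow> real^'n \<Rightarrow> real" where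
  "dunkl_laplacian Rp \<kappa> f x =
     (\<Sum>j\<in>UNIV. dunkl_operator Rp \<kappa> j (dunkl_operator Rp \<kappa> j f) x)"

end

theory Submission imports Defs begin

text \<open>
  Let \<open>h\<close> be a nonnegative Dunkl harmonic function; up to sign and an additive constant this is the
  situation of the theorem. The idea is that \<open>h\<close> has a Dunkl spherical harmonic expansion whose
  component of degree \<open>m\<close> grows exactly like \<open>r ^ m\<close>, whereas nonnegativity bounds every component
  by the one of degree \<open>0\<close>, which is the constant \<open>h 0\<close>. So only degree \<open>0\<close> occurs.

  The proof below replaces spheres by radial test functions. The Dunkl operators are antisymmetric
  with respect to the measure with density \<open>\<Prod>v. \<bar>x \<bullet> v\<bar> powr \<kappa> v\<close>, \<open>v\<close> running over the roots
  (\<open>dunkl_operator_antisymmetric\<close>), so a harmonic \<open>u\<close> is orthogonal to the Dunkl Laplacian of every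
  sufficiently smooth compactly supported function. The test functions are \<open>p x * max 0 (s - x \<bullet> x) ^ k\<close> with a
  homogeneous polynomial \<open>p\<close> of degree \<open>m\<close>; their Laplacian is explicit
  (\<open>dunkl_laplacian_hompoly_bump\<close>) and consists of test functions of the same kind, with \<open>p\<close> or its Dunkl Laplacian,
  of degree at most \<open>m - 2\<close>, as the polynomial factor. If the moments with the latter are already known to
  vanish, the moments of \<open>u\<close> against \<open>p\<close> satisfy an Euler differential equation in \<open>s\<close>, hence
  are a constant times a fixed power of \<open>s\<close> (\<open>weakly_harmonic_moment_powr\<close>).

  Apply this to \<open>u x = h x - h 0\<close>. For \<open>m = 0\<close> the constant is zero because \<open>u\<close> is small near the
  origin; this is the mean value property. For \<open>m > 0\<close> the bound \<open>\<bar>u x\<bar> \<le> u x + 2 * h 0\<close> and the mean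
  value property show that the moment grows at most like \<open>s powr (m / 2)\<close> times the weighted volume of the ball of
  radius \<open>sqrt s\<close>, while the power law says \<open>s powr m\<close> times that volume; so the constant is zero
  again (\<open>moment_eq_0\<close>). All polynomial moments of \<open>u\<close> vanish, and the Stone-Weierstrass theorem gives \<open>u = 0\<close>.
\<close>

section \<open>Integration of compactly supported functions\<close>

lemma integrable_compact_support:
  fixes F :: "'a::euclidean_space \<Rightarrow> real"
  assumes "continuous_on UNIV F" "\<And>x. norm x > r \<Longrightarrow> F x = 0"
  shows "integrable lborel F"
proof -
  have "integrable lborel (\<lambda>x. indicator (cball 0 r) x *\<^sub>R F x)"
    by (rule borel_integrable_compact) (auto intro: continuous_on_subset assms)
  also have "(\<lambda>x. indicator (cball 0 r) x *\<^sub>R F x) = F"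
    using assms(2) by (fastforce simp: indicator_def fun_eq_iff)
  finally show ?thesis .
qed

lemma nn_integral_lborel_translation:
  fixes H :: "'a::euclidean_space \<Rightarrow> ennreal"
  assumes [measurable]: "H \<in> borel_measurable borel"
  shows "(\<integral>\<^sup>+x. H (x + c) \<partial>lborel) = (\<integral>\<^sup>+x. H x \<partial>lborel)"
proof -
  have "(\<integral>\<^sup>+x. H x \<partial>lborel) = (\<integral>\<^sup>+x. H x \<partial>distr lborel borel ((+) c))"
    by (simp add: lborel_distr_plus)
  also have "\<dots> = (\<integral>\<^sup>+x. H (x + c) \<partial>lborel)"
    by (subst nn_integral_distr) (auto simp: add.commute)
  finally show ?thesis by simp
qed

lemma nn_integral_lborel_uminus:
  fixes H :: "'a::euclidean_space \<Rightarrow> ennreal"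
  assumes [measurable]: "H \<in> borel_measurable borel"
  shows "(\<integral>\<^sup>+x. H (- x) \<partial>lborel) = (\<integral>\<^sup>+x. H x \<partial>lborel)"
proof -
  have "distr lborel borel uminus = (lborel :: 'a measure)"
    by (subst (2) lborel_affine[of "- 1" 0]) (auto simp: density_1 one_ennreal_def[symmetric])
  then have "(\<integral>\<^sup>+x. H x \<partial>lborel) = (\<integral>\<^sup>+x. H x \<partial>distr lborel borel uminus)"
    by simp
  also have "\<dots> = (\<integral>\<^sup>+x. H (- x) \<partial>lborel)"
    by (subst nn_integral_distr) auto
  finally show ?thesis by simp
qed

text \<open>The uniqueness argument for Haar measure: if \<open>F\<close> is the indicator of a Borel set and \<open>G\<close> that of
  the unit ball, then Tonelli's theorem and translations turn \<open>\<integral>\<integral> F (g x) * G (y + g x)\<close> both into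
  \<open>\<integral> F (g x)\<close> times the volume of the ball and into \<open>\<integral> F\<close> times that volume, because \<open>G \<circ> g = G\<close>.\<close>
lemma lborel_distr_isometry:
  fixes g :: "'a::euclidean_space \<Rightarrow> 'a"
  assumes lin: "linear g" and iso: "\<And>x. norm (g x) = norm x"
  shows "distr lborel borel g = lborel"
proof (rule measure_eqI)
  fix A assume "A \<in> sets (distr lborel borel g)"
  then have A[measurable]: "A \<in> sets borel" by simp
  have cont: "continuous_on UNIV g"
    using lin by (simp add: linear_continuous_on linear_conv_bounded_linear)
  have [measurable]: "g \<in> borel_measurable borel"
    by (rule borel_measurable_continuous_onI[OF cont])
  have "inj g"
    using lin iso by (metis linear_injective_0 norm_eq_zero)
  then have "surj g"
    using lin linear_injective_imp_surjective by blast
  define F G :: "'a \<Rightarrow> ennreal" where "F = indicator A" and "G = indicator (ball 0 1)"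
  have [measurable]: "F \<in> borel_measurable borel" "G \<in> borel_measurable borel"
    by (auto simp: F_def G_def intro!: borel_measurable_indicator)
  define a where "a = (\<integral>\<^sup>+y. G y \<partial>lborel)"
  have Gg: "G (g x) = G x" for x
    by (simp add: G_def indicator_def iso)
  have a_eq: "a = emeasure lborel (ball (0::'a) 1)"
    by (simp add: a_def G_def)
  have "Gamma (real DIM('a) / 2 + 1) > 0"
    by (rule Gamma_real_pos) simp
  then have "Gamma (real DIM('a) / 2 + 1) \<noteq> 0"
    by (rule less_imp_neq[THEN not_sym])
  then have a: "a \<noteq> 0" "a \<noteq> \<infinity>"
    using emeasure_lborel_ball_finite[of "0::'a" 1] unfolding a_eq
    by (auto simp: emeasure_ball unit_ball_vol_def)
  have "(\<integral>\<^sup>+x. F (g x) \<partial>lborel) * a = (\<integral>\<^sup>+x. F (g x) * (\<integral>\<^sup>+y. G (y + g x) \<partial>lborel) \<partial>lborel)"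
    by (simp add: a_def nn_integral_lborel_translation nn_integral_multc)
  also have "\<dots> = (\<integral>\<^sup>+x. (\<integral>\<^sup>+y. F (g x) * G (y + g x) \<partial>lborel) \<partial>lborel)"
    by (simp add: nn_integral_cmult)
  also have "\<dots> = (\<integral>\<^sup>+y. (\<integral>\<^sup>+x. F (g x) * G (y + g x) \<partial>lborel) \<partial>lborel)"
    by (rule lborel_pair.Fubini'[symmetric]) measurable
  also have "\<dots> = (\<integral>\<^sup>+y. (\<integral>\<^sup>+x. F (g x - y) * G (g x) \<partial>lborel) \<partial>lborel)"
  proof (rule nn_integral_cong)
    fix y :: 'a
    obtain d where d: "g d = y" using \<open>surj g\<close> by (metis surjD)
    have "(\<integral>\<^sup>+x. F (g (x + d) - y) * G (g (x + d)) \<partial>lborel) = (\<integral>\<^sup>+x. F (g x - y) * G (g x) \<partial>lborel)"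
      by (rule nn_integral_lborel_translation[where H = "\<lambda>x. F (g x - y) * G (g x)"]) measurable
    then show "(\<integral>\<^sup>+x. F (g x) * G (y + g x) \<partial>lborel) = (\<integral>\<^sup>+x. F (g x - y) * G (g x) \<partial>lborel)"
      by (simp add: linear_add[OF lin] d add.commute)
  qed
  also have "\<dots> = (\<integral>\<^sup>+x. (\<integral>\<^sup>+y. F (g x - y) * G (g x) \<partial>lborel) \<partial>lborel)"
    by (rule lborel_pair.Fubini') measurable
  also have "\<dots> = (\<integral>\<^sup>+x. (\<integral>\<^sup>+y. F y \<partial>lborel) * G (g x) \<partial>lborel)"
  proof (rule nn_integral_cong)
    fix x
    have "(\<integral>\<^sup>+y. F (g x - y) \<partial>lborel) = (\<integral>\<^sup>+y. F (g x + y) \<partial>lborel)"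
      using nn_integral_lborel_uminus[of "\<lambda>y. F (g x + y)"] by simp
    also have "\<dots> = (\<integral>\<^sup>+y. F y \<partial>lborel)"
      using nn_integral_lborel_translation[of F "g x"] by (simp add: add.commute)
    finally show "(\<integral>\<^sup>+y. F (g x - y) * G (g x) \<partial>lborel) = (\<integral>\<^sup>+y. F y \<partial>lborel) * G (g x)"
      by (simp add: nn_integral_multc)
  qed
  also have "\<dots> = (\<integral>\<^sup>+y. F y \<partial>lborel) * a"
    by (simp add: Gg nn_integral_cmult a_def)
  finally have "(\<integral>\<^sup>+x. F (g x) \<partial>lborel) = (\<integral>\<^sup>+y. F y \<partial>lborel)"
    using a ennreal_mult_cancel_left[of a] by (simp add: mult.commute[of _ a])
  moreover have "(\<integral>\<^sup>+x. F (g x) \<partial>lborel) = (\<integral>\<^sup>+x. F x \<partial>distr lborel borel g)"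
    by (simp add: nn_integral_distr)
  ultimately show "emeasure (distr lborel borel g) A = emeasure lborel A"
    by (simp add: F_def)
qed simp

lemma integral_lborel_isometry:
  fixes g :: "'a::euclidean_space \<Rightarrow> 'a" and F :: "'a \<Rightarrow> real"
  assumes lin: "linear g" and iso: "\<And>x. norm (g x) = norm x" and F: "continuous_on UNIV F"
  shows "(\<integral>x. F (g x) \<partial>lborel) = (\<integral>x. F x \<partial>lborel)"
proof -
  have [measurable]: "g \<in> borel_measurable borel"
    using lin by (intro borel_measurable_continuous_onI) 
      (simp add: linear_continuous_on linear_conv_bounded_linear)
  have [measurable]: "F \<in> borel_measurable borel"
    by (rule borel_measurable_continuous_onI[OF F])
  have "(\<integral>x. F (g x) \<partial>lborel) = (\<integral>x. F x \<partial>distr lborel borel g)"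
    by (simp add: integral_distr)
  then show ?thesis by (simp add: lborel_distr_isometry[OF lin iso])
qed

lemma integral_lborel_translation:
  fixes F :: "'a::euclidean_space \<Rightarrow> real"
  assumes F: "continuous_on UNIV F"
  shows "(\<integral>x. F (x + c) \<partial>lborel) = (\<integral>x. F x \<partial>lborel)"
proof -
  have [measurable]: "F \<in> borel_measurable borel"
    by (rule borel_measurable_continuous_onI[OF F])
  have "(\<integral>x. F (x + c) \<partial>lborel) = (\<integral>x. F x \<partial>distr lborel borel ((+) c))"
    by (subst integral_distr) (auto simp: add.commute)
  then show ?thesis by (simp add: lborel_distr_plus)
qed

text \<open>By translation invariance all difference quotients of \<open>F\<close> in the
  direction \<open>e\<close> have integral zero, and they converge boundedly to the derivative.\<close>
lemma integral_directional_derivative_eq_0: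
  fixes F F' :: "'a::euclidean_space \<Rightarrow> real"
  assumes der: "\<And>x. ((\<lambda>t. F (x + t *\<^sub>R e)) has_real_derivative F' x) (at 0)"
    and F: "continuous_on UNIV F" and F': "continuous_on UNIV F'"
    and supp: "\<And>x. norm x > r \<Longrightarrow> F x = 0"
  shows "(\<integral>x. F' x \<partial>lborel) = 0"
proof -
  define t where "t n = 1 / real (Suc n)" for n
  have t: "0 < t n" "t n \<le> 1" for n by (auto simp: t_def)
  have t0: "t \<longlonglongrightarrow> 0" unfolding t_def using LIMSEQ_inverse_real_of_nat by (simp add: inverse_eq_divide)
  define s where "s n x = (F (x + t n *\<^sub>R e) - F x) / t n" for n x
  have int: "integrable lborel F" by (rule integrable_compact_support[OF F supp])
  have Fc: "continuous_on UNIV (\<lambda>x. F (x + c))" for c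
    by (rule continuous_on_compose2[OF F]) (auto intro!: continuous_intros)
  have int': "integrable lborel (\<lambda>x. F (x + c))" for c
  proof (rule integrable_compact_support[OF Fc])
    show "F (x + c) = 0" if "norm x > r + norm c" for x
      using that norm_triangle_ineq4[of "x + c" c] by (intro supp) auto
  qed
  have s0: "(\<integral>x. s n x \<partial>lborel) = 0" for n
    unfolding s_def by (simp add: int int' integral_lborel_translation[OF F])
  have der': "((\<lambda>t. F (x + t *\<^sub>R e)) has_real_derivative F' (x + u *\<^sub>R e)) (at u)" for x u
  proof -
    have "((\<lambda>t. F ((x + u *\<^sub>R e) + t *\<^sub>R e)) has_real_derivative F' (x + u *\<^sub>R e)) (at (u - u))"
      using der[of "x + u *\<^sub>R e"] by simp
    then have "((\<lambda>t. F ((x + u *\<^sub>R e) + (t - u) *\<^sub>R e)) has_real_derivative F' (x + u *\<^sub>R e) * 1) (at u)"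
      by (rule DERIV_chain2) (auto intro!: derivative_eq_intros)
    then show ?thesis by (simp add: algebra_simps)
  qed
  have "compact (cball (0::'a) (r + 2 * norm e))" by simp
  then have "bounded (F' ` cball 0 (r + 2 * norm e))"
    by (intro compact_imp_bounded compact_continuous_image) (auto intro: continuous_on_subset[OF F'])
  then obtain M where M: "\<And>x. norm x \<le> r + 2 * norm e \<Longrightarrow> \<bar>F' x\<bar> \<le> M"
    by (force simp: bounded_iff)
  define B where "B x = indicator (cball 0 (r + norm e)) x *\<^sub>R M" for x :: 'a
  have sB: "\<bar>s n x\<bar> \<le> B x" for n x
  proof (cases "norm x \<le> r + norm e")
    case True
    obtain z where z: "0 < z" "z < t n" "F (x + t n *\<^sub>R e) - F (x + 0 *\<^sub>R e) = (t n - 0) * F' (x + z *\<^sub>R e)"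
      using MVT2[of 0 "t n" "\<lambda>t. F (x + t *\<^sub>R e)" "\<lambda>u. F' (x + u *\<^sub>R e)"] der' t by auto
    have "norm (x + z *\<^sub>R e) \<le> norm x + norm e"
      using z t[of n] norm_triangle_ineq[of x "z *\<^sub>R e"] mult_right_mono[of z 1 "norm e"] by auto
    then have "\<bar>F' (x + z *\<^sub>R e)\<bar> \<le> M" using True by (intro M) auto
    moreover have "s n x = F' (x + z *\<^sub>R e)" using z t[of n] by (simp add: s_def)
    ultimately show ?thesis using True by (simp add: B_def)
  next
    case False
    have "norm (x + t n *\<^sub>R e) \<ge> norm x - norm e"
      using t[of n] norm_triangle_ineq4[of "x + t n *\<^sub>R e" "t n *\<^sub>R e"] mult_right_mono[of "t n" 1 "norm e"] by auto
    then have "F (x + t n *\<^sub>R e) = 0" using False by (intro supp) auto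
    moreover have "F x = 0" using False norm_ge_zero[of e] by (intro supp) linarith
    ultimately show ?thesis using False by (simp add: s_def B_def)
  qed
  have lim: "(\<lambda>n. s n x) \<longlonglongrightarrow> F' x" for x
  proof -
    have "((\<lambda>h. (F (x + h *\<^sub>R e) - F x) / h) \<longlongrightarrow> F' x) (at 0)"
      using der[of x] by (simp add: DERIV_def)
    moreover have "filterlim t (at 0) sequentially"
      using t0 t by (auto simp: filterlim_at intro!: always_eventually) (metis less_irrefl)
    ultimately show ?thesis unfolding s_def by (rule filterlim_compose)
  qed
  have "(\<lambda>n. \<integral>x. s n x \<partial>lborel) \<longlonglongrightarrow> (\<integral>x. F' x \<partial>lborel)"
  proof (rule integral_dominated_convergence)
    show "F' \<in> borel_measurable lborel" using borel_measurable_continuous_onI[OF F'] by simp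
    show "s n \<in> borel_measurable lborel" for n
      unfolding s_def using borel_measurable_continuous_onI[OF F] borel_measurable_continuous_onI[OF Fc] by simp
    show "integrable lborel B" unfolding B_def
      by (intro borel_integrable_compact) auto
  qed (auto simp: lim sB)
  then show ?thesis by (simp add: s0 LIMSEQ_const_iff)
qed

lemma AE_inner_neq_0:
  fixes v :: "'a::euclidean_space"
  assumes "v \<noteq> 0"
  shows "AE x in lborel. x \<bullet> v \<noteq> 0"
proof -
  have "negligible {x. v \<bullet> x = 0}"
    using assms by (intro negligible_hyperplane) auto
  then have "{x. v \<bullet> x = 0} \<in> null_sets lborel"
    by (simp add: negligible_iff_null_sets null_sets_completion_iff closed_hyperplane borel_closed)
  then show ?thesis
    by (rule AE_I') (auto simp: inner_commute)
qed

lemma has_integral_lborel_superset: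
  fixes F :: "'a::euclidean_space \<Rightarrow> real"
  assumes "integrable lborel F" "\<And>x. x \<notin> S \<Longrightarrow> F x = 0"
  shows "(F has_integral (\<integral>x. F x \<partial>lborel)) S"
proof -
  have "(\<lambda>x. if x \<in> S then F x else 0) = F"
    using assms(2) by auto
  then show ?thesis
    using has_integral_integral_lborel[OF assms(1)] has_integral_restrict_UNIV[of S F] by simp
qed

lemma continuous_nonneg_integral_0_imp_0:
  fixes F :: "'a::euclidean_space \<Rightarrow> real"
  assumes F: "continuous_on UNIV F" "integrable lborel F" and nonneg: "\<And>x. F x \<ge> 0"
    and int: "(\<integral>x. F x \<partial>lborel) = 0"
  shows "F x = 0"
proof -
  let ?B = "cbox (x - One) (x + One)"
  have I: "(F has_integral 0) UNIV"
    using has_integral_integral_lborel[OF F(2)] int by simp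
  have Fi: "F integrable_on ?B"
    by (rule integrable_continuous) (rule continuous_on_subset[OF F(1)], simp)
  have "integral ?B F \<le> integral UNIV F"
    using I by (intro integral_subset_le Fi) (auto simp: nonneg has_integral_integrable)
  moreover have "integral ?B F \<ge> 0" by (rule integral_nonneg[OF Fi nonneg])
  ultimately have "integral ?B F = 0" using I by (simp add: integral_unique)
  then have "(F has_integral 0) ?B" using Fi by (metis integrable_integral)
  then show ?thesis
    by (rule has_integral_0_cbox_imp_0[rotated 2])
      (auto simp: nonneg mem_box inner_simps box_ne_empty intro: continuous_on_subset[OF F(1)])
qed

section \<open>Continuously differentiable functions and the Dunkl difference quotient\<close>

text \<open>A relational form of \<^const>\<open>C1\<close>: carrying the gradient along gives rules that compute it.\<close>
definition has_cgrad :: "(real^'n \<Rightarrow> real) \<Rightarrow> (real^'n \<Rightarrow> real^'n) \<Rightarrow> bool" where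
  "has_cgrad f F \<longleftrightarrow> continuous_on UNIV F \<and> (\<forall>x. GDERIV f x :> F x)"

lemma GDERIV_line:
  assumes "GDERIV f x :> D"
  shows "((\<lambda>t. f (x + t *\<^sub>R e)) has_real_derivative (e \<bullet> D)) (at 0)"
proof -
  have "((\<lambda>t::real. x + t *\<^sub>R e) has_derivative (\<lambda>t. t *\<^sub>R e)) (at 0)"
    by (auto intro!: derivative_eq_intros)
  moreover have "(f has_derivative (\<lambda>h. h \<bullet> D)) (at (x + 0 *\<^sub>R e))"
    using assms by (simp add: gderiv_def)
  ultimately have "((\<lambda>t. f (x + t *\<^sub>R e)) has_derivative (\<lambda>t. (t *\<^sub>R e) \<bullet> D)) (at 0)"
    by (rule has_derivative_compose)
  then show ?thesis by (simp add: has_field_derivative_def mult_commute_abs)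
qed

lemma has_cgrad_partial_deriv:
  assumes "has_cgrad f F"
  shows "partial_deriv j f x = F x $ j"
  unfolding partial_deriv_def using assms
  by (intro DERIV_imp_deriv) (use GDERIV_line[of f x "F x" "axis j 1"] in \<open>simp add: has_cgrad_def inner_axis'\<close>)

lemma has_cgrad_continuous:
  assumes "has_cgrad f F"
  shows "continuous_on UNIV f"
proof -
  have "f differentiable (at x)" for x
    using assms unfolding has_cgrad_def gderiv_def differentiable_def by blast
  then show ?thesis
    by (simp add: continuous_at_imp_continuous_on differentiable_imp_continuous_within)
qed

lemma C1_iff_has_cgrad: "C1 f \<longleftrightarrow> has_cgrad f (\<lambda>x. \<chi> j. partial_deriv j f x)"
proof
  assume C1: "C1 f"
  have "GDERIV f x :> (\<chi> j. partial_deriv j f x)" for x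
  proof -
    obtain f' where f': "(f has_derivative f') (at x)"
      using C1 unfolding C1_def differentiable_on_def differentiable_def by auto
    then interpret bounded_linear f' by (rule has_derivative_bounded_linear)
    have pd: "partial_deriv j f x = f' (axis j 1)" for j
    proof -
      have "((\<lambda>t::real. x + t *\<^sub>R axis j 1) has_derivative (\<lambda>t. t *\<^sub>R axis j 1)) (at 0)"
        by (auto intro!: derivative_eq_intros)
      moreover have "(f has_derivative f') (at (x + 0 *\<^sub>R axis j 1))"
        using f' by simp
      ultimately have "((\<lambda>t. f (x + t *\<^sub>R axis j 1)) has_derivative (\<lambda>t. f' (t *\<^sub>R axis j 1))) (at 0)"
        by (rule has_derivative_compose)
      then show ?thesis unfolding partial_deriv_def
        by (intro DERIV_imp_deriv) (simp add: has_field_derivative_def scaleR mult_commute_abs)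
    qed
    have "f' h = h \<bullet> (\<chi> j. partial_deriv j f x)" for h
    proof -
      have "f' h = f' (\<Sum>j\<in>UNIV. h $ j *\<^sub>R axis j 1)"
        by (simp add: basis_expansion scalar_mult_eq_scaleR[symmetric])
      also have "\<dots> = (\<Sum>j\<in>UNIV. h $ j * f' (axis j 1))"
        by (simp add: sum scaleR)
      finally show ?thesis by (simp add: inner_vec_def pd)
    qed
    then show ?thesis using f' unfolding gderiv_def by presburger
  qed
  then show "has_cgrad f (\<lambda>x. \<chi> j. partial_deriv j f x)"
    using C1 by (auto simp: has_cgrad_def C1_def intro!: continuous_intros)
next
  assume *: "has_cgrad f (\<lambda>x. \<chi> j. partial_deriv j f x)"
  have "continuous_on UNIV (\<lambda>x. (\<chi> j. partial_deriv j f x) $ j)" for j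
    using * unfolding has_cgrad_def by (intro continuous_on_component) auto
  then have "continuous_on UNIV (partial_deriv j f)" for j
    by simp
  then show "C1 f"
    using * unfolding C1_def has_cgrad_def gderiv_def differentiable_on_def differentiable_def by auto
qed

lemma has_cgrad_const: "has_cgrad (\<lambda>x. c) (\<lambda>x. 0)"
  by (simp add: has_cgrad_def GDERIV_const)

lemma has_cgrad_add:
  "has_cgrad f F \<Longrightarrow> has_cgrad g G \<Longrightarrow> has_cgrad (\<lambda>x. f x + g x) (\<lambda>x. F x + G x)"
  by (auto simp: has_cgrad_def intro!: GDERIV_add continuous_intros)

lemma has_cgrad_mult:
  "has_cgrad f F \<Longrightarrow> has_cgrad g G \<Longrightarrow>
    has_cgrad (\<lambda>x. f x * g x) (\<lambda>x. f x *\<^sub>R G x + g x *\<^sub>R F x)"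
  using has_cgrad_continuous[of f F] has_cgrad_continuous[of g G]
  by (auto simp: has_cgrad_def intro!: GDERIV_mult continuous_intros)

lemma has_cgrad_cmult: "has_cgrad f F \<Longrightarrow> has_cgrad (\<lambda>x. c * f x) (\<lambda>x. c *\<^sub>R F x)"
  using has_cgrad_mult[OF has_cgrad_const] by simp

lemma has_cgrad_sum:
  assumes "finite I" "\<And>i. i \<in> I \<Longrightarrow> has_cgrad (f i) (F i)"
  shows "has_cgrad (\<lambda>x. \<Sum>i\<in>I. f i x) (\<lambda>x. \<Sum>i\<in>I. F i x)"
  using assms by (induction) (auto intro: has_cgrad_add simp: has_cgrad_const)

lemma has_cgrad_inner: "has_cgrad (\<lambda>x. x \<bullet> a) (\<lambda>x. a)"
  by (auto simp: has_cgrad_def gderiv_def intro!: derivative_eq_intros)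

lemma has_cgrad_nth: "has_cgrad (\<lambda>x. x $ i) (\<lambda>x. axis i 1)"
  using has_cgrad_inner[of "axis i 1"] by (simp add: inner_axis)

lemma has_cgrad_eq_0_outside:
  assumes g: "has_cgrad g G" and supp: "\<And>x. norm x > r \<Longrightarrow> g x = 0" and x: "norm x > r"
  shows "G x = 0"
proof -
  have "((\<lambda>x. 0::real) has_derivative (\<lambda>h. h \<bullet> G x)) (at x)"
  proof (rule has_derivative_transform_within_open)
    show "(g has_derivative (\<lambda>h. h \<bullet> G x)) (at x)"
      using g by (simp add: has_cgrad_def gderiv_def)
    show "open {x. norm x > r}" by (intro open_Collect_less continuous_intros)
  qed (use x supp in auto)
  moreover have "((\<lambda>x. 0::real) has_derivative (\<lambda>h. 0)) (at x)" by simp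
  ultimately have "(\<lambda>h. h \<bullet> G x) = (\<lambda>h. 0)" by (rule has_derivative_unique)
  then have "G x \<bullet> G x = 0" by meson
  then show ?thesis by simp
qed

lemma GDERIV_ln_inner_square:
  assumes "e > 0"
  shows "GDERIV (\<lambda>x. c / 2 * ln ((x \<bullet> v)\<^sup>2 + e)) x :> (c * (x \<bullet> v) / ((x \<bullet> v)\<^sup>2 + e)) *\<^sub>R v"
proof -
  have "(x \<bullet> v)\<^sup>2 + e > 0" using assms by (simp add: add_nonneg_pos)
  then show ?thesis unfolding gderiv_def
    by (auto intro!: derivative_eq_intros simp: field_simps)
qed

subsection \<open>Reflections\<close>

lemma reflection_eq: "reflection v x = x - (2 * (x \<bullet> v) / (v \<bullet> v)) *\<^sub>R v"
  by (simp add: reflection_def power2_norm_eq_inner)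

lemma linear_reflection: "linear (reflection v)"
  by (rule linearI) (auto simp: reflection_def inner_add_left algebra_simps add_divide_distrib)

lemma inner_reflection: "reflection v x \<bullet> y = x \<bullet> reflection v y"
  by (simp add: reflection_eq inner_diff_left inner_diff_right inner_commute)

lemma inner_reflection_self: "v \<noteq> 0 \<Longrightarrow> reflection v x \<bullet> v = - (x \<bullet> v)"
  by (simp add: reflection_eq inner_diff_left)

lemma reflection_reflection: "v \<noteq> 0 \<Longrightarrow> reflection v (reflection v x) = x"
  by (subst reflection_eq, subst inner_reflection_self) (simp_all add: reflection_eq)

lemma norm_reflection: "v \<noteq> 0 \<Longrightarrow> norm (reflection v x) = norm x"
  by (simp add: norm_eq_sqrt_inner inner_reflection reflection_reflection)

lemma continuous_on_reflection [continuous_intros]: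
  assumes "continuous_on S f"
  shows "continuous_on S (\<lambda>x. reflection v (f x))"
  unfolding reflection_eq by (cases "v = 0") (auto intro!: continuous_intros assms)

subsection \<open>The difference quotient\<close>

text \<open>The complement of a hyperplane accumulates at every point of the hyperplane, so a continuous
  function that is the quotient off the hyperplane is also its limit there.\<close>
lemma dunkl_quotient_eqI:
  assumes "v \<noteq> 0" and q: "continuous_on UNIV q"
    and eq: "\<And>x. f x - f (reflection v x) = q x * (x \<bullet> v)"
  shows "dunkl_quotient v f = q"
proof
  fix x
  show "dunkl_quotient v f x = q x"
  proof (cases "x \<bullet> v = 0")
    case False
    then show ?thesis by (simp add: dunkl_quotient_def eq)
  next
    case True
    have "x islimpt {y. y \<bullet> v \<noteq> 0}"
      unfolding islimpt_approachable
    proof (intro allI impI)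
      fix e :: real assume "e > 0"
      then show "\<exists>y\<in>{y. y \<bullet> v \<noteq> 0}. y \<noteq> x \<and> dist y x < e"
        using \<open>v \<noteq> 0\<close> True
        by (intro bexI[of _ "x + (e / (2 * norm v)) *\<^sub>R v"]) (auto simp: dist_norm inner_add_left)
    qed
    then have "at x within {y. y \<bullet> v \<noteq> 0} \<noteq> bot"
      by (simp add: trivial_limit_within)
    moreover have "(q \<longlongrightarrow> q x) (at x within {y. y \<bullet> v \<noteq> 0})"
      using q by (meson UNIV_I continuous_on_def subset_UNIV tendsto_within_subset)
    then have "((\<lambda>y. (f y - f (reflection v y)) / (y \<bullet> v)) \<longlongrightarrow> q x) (at x within {y. y \<bullet> v \<noteq> 0})"
      by (rule Lim_transform_eventually) (auto simp: eventually_at_filter eq)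
    ultimately show ?thesis using True by (simp add: dunkl_quotient_def tendsto_Lim)
  qed
qed

text \<open>As \<open>t\<close> runs from \<open>0\<close> to \<open>1\<close>, the point moves along the segment from \<open>x\<close> to its mirror image.\<close>
definition toward_reflection :: "real^'n \<Rightarrow> real \<Rightarrow> real^'n \<Rightarrow> real^'n" where
  "toward_reflection v t x = x - (t * (2 * (x \<bullet> v) / (v \<bullet> v))) *\<^sub>R v"

lemma continuous_on_toward_reflection [continuous_intros]:
  assumes "continuous_on S f" "continuous_on S g"
  shows "continuous_on S (\<lambda>x. toward_reflection v (g x) (f x))"
  unfolding toward_reflection_def by (cases "v = 0") (auto intro!: continuous_intros assms)

lemma inner_toward_reflection: "toward_reflection v t x \<bullet> y = x \<bullet> toward_reflection v t y"
  by (simp add: toward_reflection_def inner_diff_left inner_diff_right inner_commute)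

lemma linear_toward_reflection: "linear (toward_reflection v t)"
  by (rule linearI) (auto simp: toward_reflection_def inner_add_left algebra_simps add_divide_distrib)

text \<open>Hadamard's lemma: integrating the derivative of \<open>f\<close> along the segment from \<open>x\<close> to its mirror image
  splits off the factor \<open>x \<bullet> v\<close>. The integral also makes sense on the hyperplane and is locally bounded.\<close>
lemma dunkl_quotient_C1:
  assumes f: "has_cgrad f F" and v: "v \<noteq> 0"
  defines "q \<equiv> (\<lambda>x. 2 / (v \<bullet> v) * integral (cbox 0 1) (\<lambda>t. F (toward_reflection v t x) \<bullet> v))"
  shows "dunkl_quotient v f = q" "continuous_on UNIV q" "f x - f (reflection v x) = q x * (x \<bullet> v)"
proof -
  have F: "continuous_on S F" for S using f by (auto simp: has_cgrad_def intro: continuous_on_subset)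
  show cont: "continuous_on UNIV q" unfolding q_def
    by (intro continuous_intros integral_continuous_on_param)
      (auto intro!: continuous_intros continuous_on_compose2[OF F[of UNIV]] simp: split_beta)
  show eq: "f x - f (reflection v x) = q x * (x \<bullet> v)" for x
  proof -
    define c where "c = 2 * (x \<bullet> v) / (v \<bullet> v)"
    have der: "((\<lambda>t. f (toward_reflection v t x)) has_real_derivative - c * (F (toward_reflection v t x) \<bullet> v)) (at t)" for t
    proof -
      have "((\<lambda>t. toward_reflection v t x) has_derivative (\<lambda>t. t *\<^sub>R (- c *\<^sub>R v))) (at t)"
        unfolding toward_reflection_def c_def[symmetric] by (auto intro!: derivative_eq_intros)
      moreover have "(f has_derivative (\<lambda>h. h \<bullet> F (toward_reflection v t x))) (at (toward_reflection v t x))"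
        using f by (simp add: has_cgrad_def gderiv_def)
      ultimately have "((\<lambda>t. f (toward_reflection v t x)) has_derivative (\<lambda>s. (s *\<^sub>R (- c *\<^sub>R v)) \<bullet> F (toward_reflection v t x))) (at t)"
        by (rule has_derivative_compose)
      moreover have "(\<lambda>s. (s *\<^sub>R (- c *\<^sub>R v)) \<bullet> F (toward_reflection v t x)) = (*) (- c * (F (toward_reflection v t x) \<bullet> v))"
        by (auto simp: inner_commute)
      ultimately show ?thesis by (simp only: has_field_derivative_def)
    qed
    have "((\<lambda>t. - c * (F (toward_reflection v t x) \<bullet> v)) has_integral (f (toward_reflection v 1 x) - f (toward_reflection v 0 x))) {0..1}"
    proof (rule fundamental_theorem_of_calculus)
      show "((\<lambda>t. f (toward_reflection v t x)) has_vector_derivative - c * (F (toward_reflection v t x) \<bullet> v)) (at t within {0..1})" for t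
        using der[of t] has_field_derivative_at_within has_real_derivative_iff_has_vector_derivative by blast
    qed simp
    then have "integral {0..1} (\<lambda>t. - c * (F (toward_reflection v t x) \<bullet> v)) = f (toward_reflection v 1 x) - f (toward_reflection v 0 x)"
      by (rule integral_unique)
    then have "f (toward_reflection v 1 x) - f (toward_reflection v 0 x) = - c * integral {0..1} (\<lambda>t. F (toward_reflection v t x) \<bullet> v)"
      by (simp only: integral_mult_right)
    then have "f x - f (reflection v x) = c * integral {0..1} (\<lambda>t. F (toward_reflection v t x) \<bullet> v)"
      by (simp add: toward_reflection_def reflection_eq c_def algebra_simps)
    also have "\<dots> = q x * (x \<bullet> v)" by (simp add: q_def c_def)
    finally show ?thesis .
  qed
  show "dunkl_quotient v f = q"
    by (rule dunkl_quotient_eqI[OF v cont eq])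
qed

text \<open>With Hadamard's formula this shows that the difference quotient loses only one derivative, so a
  Dunkl operator maps twice continuously differentiable functions to continuously differentiable ones.\<close>
lemma has_cgrad_integral_toward_reflection:
  assumes G: "has_cgrad G K"
  shows "has_cgrad (\<lambda>x. integral (cbox 0 1) (\<lambda>t. G (toward_reflection v t x)))
    (\<lambda>x. integral (cbox 0 1) (\<lambda>t. toward_reflection v t (K (toward_reflection v t x))))"
  unfolding has_cgrad_def
proof (intro conjI allI)
  have Gc: "continuous_on UNIV G" by (rule has_cgrad_continuous[OF G])
  have Kc: "continuous_on UNIV K" using G by (simp add: has_cgrad_def)
  have cont: "continuous_on (UNIV \<times> cbox 0 1) (\<lambda>(x, t). toward_reflection v t (K (toward_reflection v t x)))"
    by (auto intro!: continuous_intros continuous_on_compose2[OF Kc] simp: split_beta)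
  show "continuous_on UNIV (\<lambda>x. integral (cbox 0 1) (\<lambda>t. toward_reflection v t (K (toward_reflection v t x))))"
    by (rule integral_continuous_on_param[OF cont])
  fix x
  have "((\<lambda>x. integral (cbox 0 1) (\<lambda>t. G (toward_reflection v t x))) has_derivative
      integral (cbox 0 1) (\<lambda>t. blinfun_inner_left (toward_reflection v t (K (toward_reflection v t x))))) (at x within UNIV)"
  proof (rule leibniz_rule[where fx = "\<lambda>x t. blinfun_inner_left (toward_reflection v t (K (toward_reflection v t x)))"])
    fix x t
    have "(toward_reflection v t has_derivative toward_reflection v t) (at x)"
      by (rule linear_imp_has_derivative[OF linear_toward_reflection])
    moreover have "(G has_derivative (\<lambda>h. h \<bullet> K (toward_reflection v t x))) (at (toward_reflection v t x))"
      using G by (simp add: has_cgrad_def gderiv_def)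
    ultimately have "((\<lambda>x. G (toward_reflection v t x)) has_derivative (\<lambda>h. toward_reflection v t h \<bullet> K (toward_reflection v t x))) (at x)"
      by (rule has_derivative_compose)
    then show "((\<lambda>x. G (toward_reflection v t x)) has_derivative 
       (blinfun_inner_left (toward_reflection v t (K (toward_reflection v t x))))) (at x within UNIV)"
      by (simp add: inner_toward_reflection inner_commute)
  next
    show "(\<lambda>t. G (toward_reflection v t x)) integrable_on cbox 0 1" for x
      by (intro integrable_continuous continuous_on_compose2[OF Gc]) (auto intro!: continuous_intros)
    show "continuous_on (UNIV \<times> cbox 0 1) (\<lambda>(x, t). blinfun_inner_left (toward_reflection v t (K (toward_reflection v t x))))"
      using bounded_linear.continuous_on[OF bounded_linear_blinfun_inner_left cont]
      by (simp add: split_beta)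
  qed auto
  moreover have "integral (cbox 0 1) (\<lambda>t. blinfun_inner_left (toward_reflection v t (K (toward_reflection v t x))))
     = blinfun_inner_left (integral (cbox 0 1) (\<lambda>t. toward_reflection v t (K (toward_reflection v t x))))"
    by (rule integral_linear[OF _ bounded_linear_blinfun_inner_left, unfolded o_def])
      (intro integrable_continuous continuous_intros continuous_on_compose2[OF Kc], auto)
  ultimately show "GDERIV (\<lambda>x. integral (cbox 0 1) (\<lambda>t. G (toward_reflection v t x))) x :>
      integral (cbox 0 1) (\<lambda>t. toward_reflection v t (K (toward_reflection v t x)))"
    by (simp add: gderiv_def inner_commute)
qed

section \<open>Homogeneous polynomials\<close>

inductive hompoly :: "nat \<Rightarrow> (real^'n \<Rightarrow> real) \<Rightarrow> bool" where
  zero: "hompoly m (\<lambda>x. 0)"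
| const: "hompoly 0 (\<lambda>x. c)"
| coord: "hompoly m p \<Longrightarrow> hompoly (Suc m) (\<lambda>x. x $ i * p x)"
| add: "hompoly m p \<Longrightarrow> hompoly m q \<Longrightarrow> hompoly m (\<lambda>x. p x + q x)"

text \<open>The degree is \<open>m - 1\<close>, with \<open>m = 0\<close> standing for degree \<open>-1\<close>: truncated subtraction would not
  record that differentiating a constant gives zero.\<close>
definition hompoly_pred :: "nat \<Rightarrow> (real^'n \<Rightarrow> real) \<Rightarrow> bool" where
  "hompoly_pred m p \<longleftrightarrow> (case m of 0 \<Rightarrow> p = (\<lambda>x. 0) | Suc k \<Rightarrow> hompoly k p)"

lemma hompoly_pred_simps [simp]:
  "hompoly_pred 0 p \<longleftrightarrow> p = (\<lambda>x. 0)" "hompoly_pred (Suc k) p \<longleftrightarrow> hompoly k p"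
  by (simp_all add: hompoly_pred_def)

lemma hompoly_cmult: "hompoly m p \<Longrightarrow> hompoly m (\<lambda>x. c * p x)"
proof (induction rule: hompoly.induct)
  case (coord m p i)
  then show ?case using hompoly.coord[OF coord.IH, of i] by (simp add: mult.left_commute)
qed (auto simp: distrib_left intro: hompoly.intros)

lemma hompoly_sum:
  "finite I \<Longrightarrow> (\<And>i. i \<in> I \<Longrightarrow> hompoly m (p i)) \<Longrightarrow> hompoly m (\<lambda>x. \<Sum>i\<in>I. p i x)"
  by (induction rule: finite_induct) (auto intro: hompoly.intros)

lemma hompoly_inner:
  assumes "hompoly m p"
  shows "hompoly (Suc m) (\<lambda>x. (x \<bullet> a) * p x)"
proof -
  have "hompoly (Suc m) (\<lambda>x. \<Sum>i\<in>UNIV. a $ i * (x $ i * p x))"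
    by (intro hompoly_sum hompoly_cmult hompoly.coord assms) auto
  then show ?thesis by (simp add: inner_vec_def sum_distrib_left mult_ac)
qed

lemma hompoly_mult:
  assumes "hompoly m p" "hompoly l q"
  shows "hompoly (m + l) (\<lambda>x. p x * q x)"
  using assms(1)
proof (induction rule: hompoly.induct)
  case (coord m p i)
  then show ?case using hompoly.coord[OF coord.IH, of i] by (simp add: mult.assoc)
qed (auto simp: distrib_right intro: hompoly.intros hompoly_cmult assms(2))

lemma hompoly_reflection: "hompoly m p \<Longrightarrow> hompoly m (\<lambda>x. p (reflection v x))"
proof (induction rule: hompoly.induct)
  case (coord m p i)
  have "reflection v x $ i = x \<bullet> reflection v (axis i 1)" for x
    by (simp add: inner_reflection[symmetric] inner_axis)
  then show ?case using hompoly_inner[OF coord.IH] by simp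
qed (auto intro: hompoly.intros)

lemma hompoly_pred_zero: "hompoly_pred m (\<lambda>x. 0)"
  by (cases m) (auto intro: hompoly.intros)

lemma hompoly_pred_add: "hompoly_pred m p \<Longrightarrow> hompoly_pred m q \<Longrightarrow> hompoly_pred m (\<lambda>x. p x + q x)"
  by (cases m) (auto intro: hompoly.intros)

lemma hompoly_pred_cmult: "hompoly_pred m p \<Longrightarrow> hompoly_pred m (\<lambda>x. c * p x)"
  by (cases m) (auto intro: hompoly_cmult)

lemma hompoly_pred_sum:
  "finite I \<Longrightarrow> (\<And>i. i \<in> I \<Longrightarrow> hompoly_pred m (p i)) \<Longrightarrow> hompoly_pred m (\<lambda>x. \<Sum>i\<in>I. p i x)"
  by (induction rule: finite_induct) (auto intro: hompoly_pred_zero hompoly_pred_add)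

lemma hompoly_pred_coord: "hompoly_pred m p \<Longrightarrow> hompoly m (\<lambda>x. x $ i * p x)"
  by (cases m) (auto intro: hompoly.intros)

lemma hompoly_gradient:
  "hompoly m p \<Longrightarrow> \<exists>P. has_cgrad p P \<and> (\<forall>x. x \<bullet> P x = real m * p x) \<and> (\<forall>j. hompoly_pred m (\<lambda>x. P x $ j))"
proof (induction rule: hompoly.induct)
  case (zero m)
  then show ?case by (intro exI[of _ "\<lambda>x. 0"]) (simp add: has_cgrad_const hompoly_pred_zero)
next
  case (const c)
  then show ?case by (intro exI[of _ "\<lambda>x. 0"]) (simp add: has_cgrad_const)
next
  case (coord m p i)
  then obtain P where P: "has_cgrad p P" "\<And>x. x \<bullet> P x = real m * p x" "\<And>j. hompoly_pred m (\<lambda>x. P x $ j)"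
    by blast
  have "hompoly m (\<lambda>x. x $ i * P x $ j + axis i 1 $ j * p x)" for j
    by (intro hompoly.add hompoly_cmult hompoly_pred_coord P coord)
  then show ?case
    by (intro exI[of _ "\<lambda>x. x $ i *\<^sub>R P x + p x *\<^sub>R axis i 1"])
       (use has_cgrad_mult[OF has_cgrad_nth P(1), of i] in
        \<open>auto simp: inner_add_right P(2) inner_axis algebra_simps\<close>)
next
  case (add m p q)
  then obtain P Q where "has_cgrad p P" "\<And>x. x \<bullet> P x = real m * p x" "\<And>j. hompoly_pred m (\<lambda>x. P x $ j)"
    "has_cgrad q Q" "\<And>x. x \<bullet> Q x = real m * q x" "\<And>j. hompoly_pred m (\<lambda>x. Q x $ j)"
    by blast
  then show ?case
    by (intro exI[of _ "\<lambda>x. P x + Q x"])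
       (auto simp: inner_add_right distrib_left intro: has_cgrad_add hompoly_pred_add)
qed

lemma hompoly_continuous: "hompoly m p \<Longrightarrow> continuous_on UNIV p"
  using hompoly_gradient has_cgrad_continuous by blast

lemma hompoly_pred_continuous: "hompoly_pred m p \<Longrightarrow> continuous_on UNIV p"
  by (cases m) (auto intro: hompoly_continuous)

text \<open>Divisibility of \<open>p - p \<circ> reflection v\<close> by \<open>x \<bullet> v\<close> is a discrete product rule.\<close>
lemma hompoly_quotient:
  assumes "v \<noteq> 0"
  shows "hompoly m p \<Longrightarrow> \<exists>q. (\<forall>x. p x - p (reflection v x) = q x * (x \<bullet> v)) \<and> hompoly_pred m q"
proof (induction rule: hompoly.induct)
  case (coord m p i)
  then obtain q where q: "\<And>x. p x - p (reflection v x) = q x * (x \<bullet> v)" "hompoly_pred m q" by blast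
  have "x $ i * p x - reflection v x $ i * p (reflection v x) =
      (x $ i * q x + (2 * v $ i / (v \<bullet> v)) * p (reflection v x)) * (x \<bullet> v)" for x
  proof -
    define c where "c = (x \<bullet> v) / (v \<bullet> v)"
    have "reflection v x $ i = x $ i - 2 * c * v $ i"
      by (simp add: reflection_eq c_def)
    then have "x $ i * p x - reflection v x $ i * p (reflection v x) =
       x $ i * (p x - p (reflection v x)) + 2 * c * v $ i * p (reflection v x)"
      by (simp only: left_diff_distrib right_diff_distrib)
    also have "\<dots> = (x $ i * q x + (2 * v $ i / (v \<bullet> v)) * p (reflection v x)) * (x \<bullet> v)"
      by (simp add: q(1) c_def distrib_right)
    finally show ?thesis .
  qed
  moreover have "hompoly m (\<lambda>x. x $ i * q x + (2 * v $ i / (v \<bullet> v)) * p (reflection v x))"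
    by (intro hompoly.add hompoly_pred_coord hompoly_cmult hompoly_reflection q coord)
  ultimately show ?case by auto
next
  case (add m p q)
  then obtain P Q where PQ: "\<And>x. p x - p (reflection v x) = P x * (x \<bullet> v)" "hompoly_pred m P"
      "\<And>x. q x - q (reflection v x) = Q x * (x \<bullet> v)" "hompoly_pred m Q" by blast
  show ?case
  proof (intro exI[of _ "\<lambda>x. P x + Q x"] conjI allI)
    show "p x + q x - (p (reflection v x) + q (reflection v x)) = (P x + Q x) * (x \<bullet> v)" for x
      using PQ(1,3)[of x] by (simp only: distrib_right)
    show "hompoly_pred m (\<lambda>x. P x + Q x)" by (rule hompoly_pred_add[OF PQ(2,4)])
  qed
qed (auto intro!: exI[of _ "\<lambda>x. 0"] hompoly_pred_zero)

lemma hompoly_bound: "hompoly m p \<Longrightarrow> \<exists>K\<ge>0. \<forall>x. \<bar>p x\<bar> \<le> K * norm x ^ m"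
proof (induction rule: hompoly.induct)
  case (const c)
  then show ?case by (intro exI[of _ "\<bar>c\<bar>"]) auto
next
  case (coord m p i)
  then obtain K where K: "K \<ge> 0" "\<And>x. \<bar>p x\<bar> \<le> K * norm x ^ m" by blast
  have "\<bar>x $ i * p x\<bar> \<le> K * norm x ^ Suc m" for x
    unfolding abs_mult using mult_mono[OF component_le_norm_cart[of x i] K(2)[of x]]
    by (simp add: mult_ac)
  then show ?case using K by blast
next
  case (add m p q)
  then obtain K L where KL: "K \<ge> 0" "\<And>x. \<bar>p x\<bar> \<le> K * norm x ^ m" "L \<ge> 0" "\<And>x. \<bar>q x\<bar> \<le> L * norm x ^ m" by blast
  have "\<bar>p x + q x\<bar> \<le> (K + L) * norm x ^ m" for x
    using KL(2)[of x] KL(4)[of x] abs_triangle_ineq[of "p x" "q x"] by (simp add: distrib_right)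
  then show ?case using KL by (intro exI[of _ "K + L"]) auto
qed auto

text \<open>An induction rule, valid because every polynomial is the sum of its homogeneous components.\<close>
lemma real_polynomial_function_hompoly_sum:
  assumes "real_polynomial_function (p :: real^'n \<Rightarrow> real)"
    and hom: "\<And>m q. hompoly m q \<Longrightarrow> S q"
    and add: "\<And>f g. S f \<Longrightarrow> S g \<Longrightarrow> S (\<lambda>x. f x + g x)"
  shows "S p"
proof -
  define D where "D p \<longleftrightarrow> (\<exists>M q. (\<forall>m. hompoly m (q m)) \<and> p = (\<lambda>x. \<Sum>m<M. q m x))" for p :: "real^'n \<Rightarrow> real"
  have Dhom: "D q" if "hompoly m q" for m q
  proof -
    have "(\<Sum>l<Suc m. (if l = m then q else (\<lambda>x. 0)) x) = q x" for x
      by (simp add: if_distrib[of "\<lambda>f. f x"] cong: if_cong)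
    then show ?thesis unfolding D_def using that
      by (intro exI[of _ "Suc m"] exI[of _ "\<lambda>l. if l = m then q else (\<lambda>x. 0)"])
         (auto simp: fun_eq_iff intro: hompoly.zero)
  qed
  have Dadd: "D (\<lambda>x. f x + g x)" if fg: "D f" "D g" for f g
  proof -
    obtain M a where a: "\<And>m. hompoly m (a m)" "f = (\<lambda>x. \<Sum>m<M. a m x)" using fg by (auto simp: D_def)
    obtain N b where b: "\<And>m. hompoly m (b m)" "g = (\<lambda>x. \<Sum>m<N. b m x)" using fg by (auto simp: D_def)
    define c where "c m = (\<lambda>x. (if m < M then a m x else 0) + (if m < N then b m x else 0))" for m
    have "hompoly m (c m)" for m
      unfolding c_def using a(1)[of m] b(1)[of m]
      by (cases "m < M"; cases "m < N") (auto intro: hompoly.add hompoly.zero)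
    moreover have "f x + g x = (\<Sum>m<M+N. c m x)" for x
    proof -
      have "(\<Sum>m<M+N. (if m < M then a m x else 0)) = (\<Sum>m<M. a m x)"
        by (rule sum.mono_neutral_cong_right) auto
      moreover have "(\<Sum>m<M+N. (if m < N then b m x else 0)) = (\<Sum>m<N. b m x)"
        by (rule sum.mono_neutral_cong_right) auto
      ultimately show ?thesis by (simp add: c_def sum.distrib a b)
    qed
    ultimately show ?thesis unfolding D_def by blast
  qed
  have Dsum: "D (\<lambda>x. \<Sum>i\<in>I. f i x)" if "finite I" "\<And>i. i \<in> I \<Longrightarrow> D (f i)" for I :: "nat set" and f
    using that by (induction) (auto intro: Dadd Dhom[OF hompoly.zero])
  have "D p" using assms(1)
  proof induction
    case (linear f)
    have "f = (\<lambda>x. (x \<bullet> (\<chi> i. f (axis i 1))) * 1)"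
    proof
      fix x
      interpret bounded_linear f by (rule linear)
      have "f x = f (\<Sum>j\<in>UNIV. x $ j *\<^sub>R axis j 1)"
        by (simp add: basis_expansion scalar_mult_eq_scaleR[symmetric])
      also have "\<dots> = (\<Sum>j\<in>UNIV. x $ j * f (axis j 1))"
        by (simp add: sum scaleR)
      finally show "f x = (x \<bullet> (\<chi> i. f (axis i 1))) * 1" by (simp add: inner_vec_def)
    qed
    then show ?case using Dhom[OF hompoly_inner[OF hompoly.const]] by metis
  next
    case (mult f g)
    then obtain M a N b where ab: "\<And>m. hompoly m (a m)" "f = (\<lambda>x. \<Sum>m<M. a m x)"
      "\<And>m. hompoly m (b m)" "g = (\<lambda>x. \<Sum>m<N. b m x)" unfolding D_def by metis
    have "(\<lambda>x. f x * g x) = (\<lambda>x. \<Sum>i<M. \<Sum>l<N. a i x * b l x)"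
      by (simp add: ab sum_product)
    then show ?case by (auto intro!: Dsum Dhom[OF hompoly_mult] ab)
  qed (auto intro: Dadd Dhom[OF hompoly.const])
  then obtain M q where q: "\<And>m. hompoly m (q m)" "p = (\<lambda>x. \<Sum>m<M. q m x)" by (auto simp: D_def)
  have "S (\<lambda>x. \<Sum>m<M. q m x)"
    by (induction M) (auto intro: hom[OF hompoly.zero] add hom[OF q(1)])
  then show ?thesis by (simp add: q)
qed

section \<open>Test functions\<close>

text \<open>Truncated powers form a family that is closed under what the proof does with it: derivatives in
  \<open>x\<close> and in \<open>s\<close> lower the exponent by one, and multiplication by \<open>s - x \<bullet> x\<close> raises it by one.\<close>
definition bump :: "nat \<Rightarrow> real \<Rightarrow> real^'n \<Rightarrow> real" where
  "bump k s x = (max 0 (s - x \<bullet> x)) ^ k"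

lemma DERIV_max_power:
  "((\<lambda>y::real. max 0 y ^ Suc (Suc k)) has_real_derivative (real (Suc (Suc k)) * max 0 y ^ Suc k)) (at y)"
proof (cases y "0::real" rule: linorder_cases)
  case less
  have "((\<lambda>y::real. 0) has_real_derivative 0) (at y)" by simp
  then have "((\<lambda>y::real. max 0 y ^ Suc (Suc k)) has_real_derivative 0) (at y)"
    by (rule has_field_derivative_transform_within_open[where S = "{..<0}"]) (use less in auto)
  then show ?thesis using less by (simp add: max_def)
next
  case equal
  have "((\<lambda>h::real. max 0 h ^ Suc k) \<longlongrightarrow> max 0 0 ^ Suc k) (at 0)"
    by (intro tendsto_intros)
  then have "((\<lambda>h::real. (max 0 (0 + h) ^ Suc (Suc k) - max 0 0 ^ Suc (Suc k)) / h) \<longlongrightarrow> max 0 0 ^ Suc k) (at 0)"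
    by (rule Lim_transform_eventually) (auto simp: eventually_at_filter max_def)
  then show ?thesis using equal by (simp add: DERIV_def)
next
  case greater
  have "((\<lambda>y::real. y ^ Suc (Suc k)) has_real_derivative real (Suc (Suc k)) * y ^ Suc k) (at y)"
    by (rule derivative_eq_intros | simp)+
  then have "((\<lambda>y::real. max 0 y ^ Suc (Suc k)) has_real_derivative real (Suc (Suc k)) * y ^ Suc k) (at y)"
    by (rule has_field_derivative_transform_within_open[where S = "{0<..}"]) (use greater in auto)
  then show ?thesis using greater by (simp add: max_def)
qed

lemma continuous_bump: "continuous_on UNIV (bump k s)"
  unfolding bump_def by (intro continuous_intros)

lemma has_cgrad_bump:
  "has_cgrad (bump (Suc (Suc k)) s) (\<lambda>x. (- 2 * real (Suc (Suc k)) * bump (Suc k) s x) *\<^sub>R x)"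
  unfolding has_cgrad_def
proof (intro conjI allI)
  show "continuous_on UNIV (\<lambda>x. (- 2 * real (Suc (Suc k)) * bump (Suc k) s x) *\<^sub>R x)"
    by (intro continuous_intros continuous_bump)
  fix x :: "real^'n"
  have "GDERIV (\<lambda>x. s - x \<bullet> x) x :> - 2 *\<^sub>R x"
    unfolding gderiv_def by (auto intro!: derivative_eq_intros simp: inner_commute)
  from GDERIV_DERIV_compose[OF this DERIV_max_power]
  show "GDERIV (bump (Suc (Suc k)) s) x :> (- 2 * real (Suc (Suc k)) * bump (Suc k) s x) *\<^sub>R x"
    unfolding bump_def by (rule GDERIV_subst) (simp only: scaleR_scaleR mult_ac)
qed

lemma bump_reflection: "v \<noteq> 0 \<Longrightarrow> bump k s (reflection v x) = bump k s x"
  by (simp add: bump_def inner_reflection reflection_reflection)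

lemma bump_Suc: "bump (Suc (Suc k)) s x = (s - x \<bullet> x) * bump (Suc k) s x"
  by (simp add: bump_def max_def)

lemma bump_nonneg: "bump k s x \<ge> 0"
  by (simp add: bump_def)

lemma bump_eq_0: 
  assumes "s \<le> r\<^sup>2" "norm x > r" "r \<ge> 0" shows "bump (Suc k) s x = 0"
proof -
  have "x \<bullet> x > r\<^sup>2"
    using power_strict_mono[OF assms(2,3), of 2] by (simp add: power2_norm_eq_inner)
  then show ?thesis using assms by (simp add: bump_def max_def)
qed

section \<open>Antisymmetry of the Dunkl operators\<close>

locale dunkl =
  fixes R Rp :: "(real^'n) set" and \<kappa> :: "real^'n \<Rightarrow> real"
  assumes root_system: "root_system R"
    and positive_subsystem: "positive_subsystem R Rp"
    and multiplicity: "multiplicity_function R \<kappa>"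
    and nonneg: "\<And>v. v \<in> R \<Longrightarrow> \<kappa> v \<ge> 0"
begin

lemma finite_R: "finite R" and nonzero: "v \<in> R \<Longrightarrow> v \<noteq> 0"
  and reflection_image: "v \<in> R \<Longrightarrow> reflection v ` R = R"
  using root_system by (auto simp: root_system_def)

lemma Rp_subset: "Rp \<subseteq> R" and finite_Rp: "finite Rp"
  using positive_subsystem finite_R finite_subset by (auto simp: positive_subsystem_def)

lemma Rp_R: "v \<in> Rp \<Longrightarrow> v \<in> R" using Rp_subset by auto

lemma kappa_reflection:
  assumes "v \<in> R" "u \<in> R"
  shows "\<kappa> (reflection v u) = \<kappa> u"
proof -
  have "reflection v \<in> coxeter_group R"
    unfolding coxeter_group_def using assms by (intro generate.incl) auto
  then show ?thesis using multiplicity assms by (simp add: multiplicity_function_def)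
qed

lemma sum_roots:
  fixes F :: "real^'n \<Rightarrow> real"
  assumes even: "\<And>v. v \<in> R \<Longrightarrow> F (- v) = F v"
  shows "(\<Sum>v\<in>R. F v) = 2 * (\<Sum>v\<in>Rp. F v)"
proof -
  obtain u where u: "\<And>v. v \<in> Rp \<Longrightarrow> u \<bullet> v > 0" and R: "R = Rp \<union> uminus ` Rp"
    using positive_subsystem unfolding positive_subsystem_def by blast
  have "Rp \<inter> uminus ` Rp = {}"
    using u by (force dest: u)
  then have "(\<Sum>v\<in>R. F v) = (\<Sum>v\<in>Rp. F v) + (\<Sum>v\<in>uminus ` Rp. F v)"
    unfolding R by (intro sum.union_disjoint) (auto simp: finite_Rp)
  also have "(\<Sum>v\<in>uminus ` Rp. F v) = (\<Sum>v\<in>Rp. F (- v))"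
    by (simp add: sum.reindex)
  also have "\<dots> = (\<Sum>v\<in>Rp. F v)"
    using even Rp_subset by (intro sum.cong) auto
  finally show ?thesis by simp
qed

lemma kappa_minus: "v \<in> R \<Longrightarrow> \<kappa> (- v) = \<kappa> v"
  using kappa_reflection[of v v] nonzero[of v] by (simp add: reflection_eq scaleR_2)

text \<open>For \<open>e = 0\<close> this is the invariant density \<open>\<Prod>v. \<bar>x \<bullet> v\<bar> powr \<kappa> v\<close>; for \<open>e > 0\<close> it is a smooth
  approximation that is still invariant. Taking all roots with half the exponent, rather than the
  positive ones, reduces invariance to a reindexing. Roots with \<open>\<kappa> v = 0\<close> are left out because
  \<open>0 powr 0 = 0\<close> would make their factor vanish on a hyperplane.\<close>
definition weight :: "real \<Rightarrow> real^'n \<Rightarrow> real" where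
  "weight e x = (\<Prod>v | v \<in> R \<and> \<kappa> v > 0. ((x \<bullet> v)\<^sup>2 + e) powr (\<kappa> v / 2))"

lemma continuous_weight: "e \<ge> 0 \<Longrightarrow> continuous_on UNIV (weight e)"
  unfolding weight_def by (intro continuous_intros continuous_on_powr') auto

lemma weight_nonneg: "weight e x \<ge> 0"
  unfolding weight_def by (intro prod_nonneg) auto

lemma weight_mono: "0 \<le> e \<Longrightarrow> e \<le> e' \<Longrightarrow> weight e x \<le> weight e' x"
  unfolding weight_def by (intro prod_mono) (auto intro!: powr_mono2)

lemma weight_pos: "(\<And>v. v \<in> R \<Longrightarrow> x \<bullet> v \<noteq> 0) \<Longrightarrow> weight 0 x > 0"
  unfolding weight_def by (intro prod_pos) auto

lemma weight_reflection:
  assumes "v \<in> R"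
  shows "weight e (reflection v x) = weight e x"
proof -
  let ?A = "{v \<in> R. \<kappa> v > 0}"
  have "inj_on (reflection v) ?A"
    using reflection_reflection[OF nonzero[OF assms]] by (intro inj_on_inverseI)
  moreover have "reflection v ` ?A = ?A"
  proof -
    have sub: "reflection v ` ?A \<subseteq> ?A"
      using reflection_image[OF assms] kappa_reflection[OF assms] by auto
    show ?thesis
    proof (rule subset_antisym[OF sub])
      show "?A \<subseteq> reflection v ` ?A"
        using sub reflection_reflection[OF nonzero[OF assms]] by (metis (no_types, lifting) image_subset_iff subsetI image_eqI)
    qed
  qed
  ultimately have "bij_betw (reflection v) ?A ?A" by (simp add: bij_betw_def)
  note bij = this
  have "weight e (reflection v x) =
      (\<Prod>u\<in>?A. ((x \<bullet> reflection v u)\<^sup>2 + e) powr (\<kappa> (reflection v u) / 2))"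
    unfolding weight_def using assms
    by (intro prod.cong) (auto simp: inner_reflection kappa_reflection)
  also have "\<dots> = weight e x"
    unfolding weight_def by (rule prod.reindex_bij_betw[OF bij])
  finally show ?thesis .
qed

text \<open>A bounded odd approximation of \<open>1 / (x \<bullet> v)\<close>. It occurs in the logarithmic derivative of
  \<open>weight e\<close>, and therefore it is also the right replacement for the quotient in the Dunkl operator.\<close>
definition reg_inverse :: "real \<Rightarrow> real^'n \<Rightarrow> real^'n \<Rightarrow> real" where
  "reg_inverse e v x = (x \<bullet> v) / ((x \<bullet> v)\<^sup>2 + e)"

lemma denom_pos: "e > 0 \<Longrightarrow> (y::real)\<^sup>2 + e > 0"
  by (simp add: add_nonneg_pos)

lemma continuous_reg_inverse: "e > 0 \<Longrightarrow> continuous_on UNIV (reg_inverse e v)"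
  unfolding reg_inverse_def using denom_pos[of e]
  by (auto intro!: continuous_intros simp: less_imp_neq[THEN not_sym])

lemma has_cgrad_weight:
  assumes e: "e > 0"
  shows "has_cgrad (weight e) (\<lambda>x. weight e x *\<^sub>R (\<Sum>v\<in>R. (\<kappa> v * reg_inverse e v x) *\<^sub>R v))"
  unfolding has_cgrad_def
proof (intro conjI allI)
  have ew: "continuous_on UNIV (weight e)" using e by (intro continuous_weight) auto
  then show "continuous_on UNIV (\<lambda>x. weight e x *\<^sub>R (\<Sum>v\<in>R. (\<kappa> v * reg_inverse e v x) *\<^sub>R v))"
    by (intro continuous_intros continuous_reg_inverse e)
  fix x
  have eq: "weight e = (\<lambda>x. exp (\<Sum>v\<in>R. \<kappa> v / 2 * ln ((x \<bullet> v)\<^sup>2 + e)))"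
  proof
    fix x
    have "weight e x = (\<Prod>v\<in>R. exp (\<kappa> v / 2 * ln ((x \<bullet> v)\<^sup>2 + e)))"
      unfolding weight_def
    proof (rule prod.mono_neutral_cong_left[OF finite_R])
      show "\<forall>i\<in>R - {v \<in> R. 0 < \<kappa> v}. exp (\<kappa> i / 2 * ln ((x \<bullet> i)\<^sup>2 + e)) = 1"
        using nonneg by (auto simp: less_le)
      fix v
      show "((x \<bullet> v)\<^sup>2 + e) powr (\<kappa> v / 2) = exp (\<kappa> v / 2 * ln ((x \<bullet> v)\<^sup>2 + e))"
        using denom_pos[OF e, of "x \<bullet> v"] by (simp add: powr_def)
    qed auto
    then show "weight e x = exp (\<Sum>v\<in>R. \<kappa> v / 2 * ln ((x \<bullet> v)\<^sup>2 + e))"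
      by (simp add: exp_sum finite_R)
  qed
  have "GDERIV (\<lambda>x. \<Sum>v\<in>S. \<kappa> v / 2 * ln ((x \<bullet> v)\<^sup>2 + e)) x :> (\<Sum>v\<in>S. (\<kappa> v * reg_inverse e v x) *\<^sub>R v)"
    if "finite S" for S
    using that
  proof induction
    case (insert v S)
    then show ?case
      using GDERIV_add[OF GDERIV_ln_inner_square[OF e, of "\<kappa> v" v x] insert.IH] by (simp add: reg_inverse_def)
  qed (simp add: GDERIV_const)
  from GDERIV_DERIV_compose[OF this[OF finite_R] DERIV_exp]
  show "GDERIV (weight e) x :> weight e x *\<^sub>R (\<Sum>v\<in>R. (\<kappa> v * reg_inverse e v x) *\<^sub>R v)"
    by (simp add: eq)
qed

lemma weight_gradient_nth:
  "(weight e x *\<^sub>R (\<Sum>v\<in>R. (\<kappa> v * reg_inverse e v x) *\<^sub>R v)) $ j =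
     weight e x * (2 * (\<Sum>v\<in>Rp. \<kappa> v * reg_inverse e v x * v $ j))"
  by (subst sum_roots[symmetric]) (simp_all add: reg_inverse_def kappa_minus)

definition regularized_operator ::
  "real \<Rightarrow> 'n \<Rightarrow> (real^'n \<Rightarrow> real) \<Rightarrow> real^'n \<Rightarrow> real" where
  "regularized_operator e j u x =
    partial_deriv j u x + (\<Sum>v\<in>Rp. \<kappa> v * ((u x - u (reflection v x)) * reg_inverse e v x) * v $ j)"

lemma continuous_partial_deriv: "has_cgrad u U \<Longrightarrow> continuous_on UNIV (partial_deriv j u)"
  by (subst ext[OF has_cgrad_partial_deriv[of u U j]])
     (auto simp: has_cgrad_def intro!: continuous_intros)

lemma continuous_on_comp_reflection:
  assumes "continuous_on UNIV u"
  shows "continuous_on UNIV (\<lambda>x. u (reflection v x))"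
  by (rule continuous_on_compose2[OF assms]) (auto intro!: continuous_on_reflection continuous_on_id)

lemma continuous_regularized:
  assumes "has_cgrad u U" "e > 0"
  shows "continuous_on UNIV (regularized_operator e j u)"
  unfolding regularized_operator_def
  by (intro continuous_intros continuous_partial_deriv[OF assms(1)] continuous_reg_inverse assms
    has_cgrad_continuous[OF assms(1)] continuous_on_comp_reflection)

lemma regularized_eq_0_outside:
  assumes g: "has_cgrad g G" and supp: "\<And>x. norm x > r \<Longrightarrow> g x = 0" and x: "norm x > r"
  shows "regularized_operator e j g x = 0"
  using has_cgrad_eq_0_outside[OF assms] has_cgrad_partial_deriv[OF g] supp[OF x]
  by (simp add: regularized_operator_def supp norm_reflection[OF nonzero[OF Rp_R]] x)

text \<open>Differentiating the weight in the integration by parts produces twice the sum of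
  \<open>\<kappa> v * v $ j * reg_inverse e v x * u x * g x\<close> over the positive roots, which the diagonal terms of
  the two regularized operators cancel. The terms with a reflected argument cancel each other under the substitution
  \<open>x \<mapsto> reflection v x\<close>, because \<open>reg_inverse e v\<close> is odd. Nothing singular is ever integrated.\<close>
lemma regularized_operator_antisymmetric:
  assumes u: "has_cgrad u U" and g: "has_cgrad g G" and supp: "\<And>x. norm x > r \<Longrightarrow> g x = 0" and e: "e > 0"
  shows "(\<integral>x. regularized_operator e j u x * g x * weight e x \<partial>lborel) =
       - (\<integral>x. u x * regularized_operator e j g x * weight e x \<partial>lborel)"
proof -
  note wc = continuous_weight[OF less_imp_le[OF e]]
  note uc = has_cgrad_continuous[OF u] and gc = has_cgrad_continuous[OF g]
  note conts = wc uc gc continuous_reg_inverse[OF e] continuous_on_comp_reflection continuous_intros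
  have supp': "norm x > r \<Longrightarrow> v \<in> Rp \<Longrightarrow> g (reflection v x) = 0" for x v
    using supp norm_reflection[OF nonzero[OF Rp_R]] by simp
  define F where "F x = u x * g x * weight e x" for x
  define W where "W x = weight e x *\<^sub>R (\<Sum>v\<in>R. (\<kappa> v * reg_inverse e v x) *\<^sub>R v)" for x
  have W: "has_cgrad (weight e) W" using has_cgrad_weight[OF e] by (simp add: W_def[abs_def])
  obtain FF where FF: "has_cgrad F FF"
    and FFj: "\<And>x. FF x $ j = partial_deriv j u x * g x * weight e x + u x * partial_deriv j g x * weight e x
        + u x * g x * weight e x * (2 * (\<Sum>v\<in>Rp. \<kappa> v * reg_inverse e v x * v $ j))"
  proof
    show "has_cgrad F (\<lambda>x. (u x * g x) *\<^sub>R W x + weight e x *\<^sub>R (u x *\<^sub>R G x + g x *\<^sub>R U x))"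
      unfolding F_def[abs_def] by (rule has_cgrad_mult[OF has_cgrad_mult[OF u g] W])
    show "((u x * g x) *\<^sub>R W x + weight e x *\<^sub>R (u x *\<^sub>R G x + g x *\<^sub>R U x)) $ j =
      partial_deriv j u x * g x * weight e x + u x * partial_deriv j g x * weight e x
        + u x * g x * weight e x * (2 * (\<Sum>v\<in>Rp. \<kappa> v * reg_inverse e v x * v $ j))" for x
      unfolding vector_add_component W_def vector_scaleR_component[of "u x * g x"] weight_gradient_nth
      unfolding vector_scaleR_component
      by (simp add: has_cgrad_partial_deriv[OF u] has_cgrad_partial_deriv[OF g] algebra_simps)
  qed
  have int0: "(\<integral>x. FF x $ j \<partial>lborel) = 0"
  proof (rule integral_directional_derivative_eq_0)
    show "((\<lambda>t. F (x + t *\<^sub>R axis j 1)) has_real_derivative FF x $ j) (at 0)" for x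
      using GDERIV_line[of F x "FF x" "axis j 1"] FF by (simp add: has_cgrad_def inner_axis')
    show "continuous_on UNIV F" using FF by (rule has_cgrad_continuous)
    show "continuous_on UNIV (\<lambda>x. FF x $ j)" using FF unfolding has_cgrad_def by (intro continuous_intros) auto
    show "norm x > r \<Longrightarrow> F x = 0" for x by (simp add: F_def supp)
  qed
  define H where "H v x = u (reflection v x) * g x * reg_inverse e v x * weight e x" for v x
  define H' where "H' v x = u x * g (reflection v x) * reg_inverse e v x * weight e x" for v x
  have Hc: "continuous_on UNIV (H v)" "continuous_on UNIV (H' v)" for v
    unfolding H_def[abs_def] H'_def[abs_def] by (intro conts)+
  have Hint: "integrable lborel (H v)" "integrable lborel (H' v)" if "v \<in> Rp" for v
    by (rule integrable_compact_support[OF Hc(1), of r], simp add: H_def supp)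
       (rule integrable_compact_support[OF Hc(2), of r], simp add: H'_def supp' that)
  have HH': "(\<integral>x. H v x \<partial>lborel) + (\<integral>x. H' v x \<partial>lborel) = 0" if v: "v \<in> Rp" for v
  proof -
    note v0 = nonzero[OF Rp_R[OF v]]
    have "(\<integral>x. H v x \<partial>lborel) = (\<integral>x. H v (reflection v x) \<partial>lborel)"
      by (rule integral_lborel_isometry[symmetric, OF linear_reflection norm_reflection[OF v0] Hc(1)])
    also have "(\<lambda>x. H v (reflection v x)) = (\<lambda>x. - H' v x)"
      using v0 Rp_R[OF v]
      by (simp add: fun_eq_iff H_def H'_def reflection_reflection weight_reflection reg_inverse_def inner_reflection_self)
    finally show ?thesis by simp
  qed
  have pointwise: "regularized_operator e j u x * g x * weight e x = FF x $ j
      - (\<Sum>v\<in>Rp. \<kappa> v * v $ j * (H v x + H' v x)) - u x * regularized_operator e j g x * weight e x" for x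
    unfolding regularized_operator_def FFj H_def H'_def
    by (simp add: algebra_simps sum.distrib sum_distrib_left sum_distrib_right sum_subtractf sum_negf)
  have int1: "integrable lborel (\<lambda>x. FF x $ j)"
    using FF has_cgrad_eq_0_outside[OF FF, of r]
    by (intro integrable_compact_support[of _ r]) (auto simp: has_cgrad_def F_def supp intro!: continuous_intros)
  have int2: "integrable lborel (\<lambda>x. u x * regularized_operator e j g x * weight e x)"
    by (rule integrable_compact_support[of _ r])
       (auto simp: regularized_eq_0_outside[OF g supp] intro!: continuous_intros uc wc continuous_regularized[OF g e])
  show ?thesis
    unfolding pointwise using HH'
    by (simp add: int0 int1 int2 Hint)
qed


lemma continuous_dunkl_operator:
  assumes u: "has_cgrad u U"
  shows "continuous_on UNIV (dunkl_operator Rp \<kappa> j u)"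
proof -
  have "continuous_on UNIV (dunkl_quotient v u)" if "v \<in> Rp" for v
    using dunkl_quotient_C1(1,2)[OF u nonzero[OF Rp_R[OF that]]] by simp
  then show ?thesis
    unfolding dunkl_operator_def
    by (intro continuous_intros continuous_partial_deriv[OF u])
qed

text \<open>By Hadamard's lemma the regularized quotients are dominated by the true one, uniformly in \<open>e\<close>, and
  they converge off the hyperplanes, which is almost everywhere. Compact support may come from \<open>\<phi>\<close> or from \<open>u\<close>.\<close>
lemma regularized_limit:
  assumes u: "has_cgrad u U" and \<phi>: "continuous_on UNIV \<phi>"
    and supp: "\<And>e x. norm x > r \<Longrightarrow> regularized_operator e j u x * \<phi> x = 0"
  shows "(\<lambda>n. \<integral>x. regularized_operator (1 / real (Suc n)) j u x * \<phi> x * weight (1 / real (Suc n)) x \<partial>lborel)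
    \<longlonglongrightarrow> (\<integral>x. dunkl_operator Rp \<kappa> j u x * \<phi> x * weight 0 x \<partial>lborel)"
proof -
  define e where "e n = 1 / real (Suc n)" for n
  have e: "e n > 0" "e n \<ge> 0" "e n \<le> 1" for n by (auto simp: e_def)
  have e0: "e \<longlonglongrightarrow> 0" unfolding e_def using LIMSEQ_inverse_real_of_nat by (simp add: inverse_eq_divide)
  define q where "q v = dunkl_quotient v u" for v
  have qc: "continuous_on UNIV (q v)" and q: "u x - u (reflection v x) = q v x * (x \<bullet> v)" if "v \<in> Rp" for v x
    using dunkl_quotient_C1[OF u nonzero[OF Rp_R[OF that]]] by (simp_all add: q_def)
  define b where "b x = \<bar>partial_deriv j u x\<bar> + (\<Sum>v\<in>Rp. \<kappa> v * \<bar>q v x\<bar> * \<bar>v $ j\<bar>)" for x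
  define B where "B x = indicator (cball 0 r) x *\<^sub>R (b x * \<bar>\<phi> x\<bar> * weight 1 x)" for x
  have bc: "continuous_on UNIV b" unfolding b_def
    by (intro continuous_intros continuous_partial_deriv[OF u] qc)
  have regb: "\<bar>regularized_operator d j u x\<bar> \<le> b x" if d: "d > 0" for d x
  proof -
    have "\<bar>\<kappa> v * ((u x - u (reflection v x)) * reg_inverse d v x) * v $ j\<bar> \<le> \<kappa> v * \<bar>q v x\<bar> * \<bar>v $ j\<bar>"
      if v: "v \<in> Rp" for v
    proof -
      have "0 \<le> (x \<bullet> v) * reg_inverse d v x" "(x \<bullet> v) * reg_inverse d v x \<le> 1"
        using denom_pos[OF d, of "x \<bullet> v"] d by (auto simp: reg_inverse_def power2_eq_square field_simps)
      then have "\<bar>q v x * ((x \<bullet> v) * reg_inverse d v x)\<bar> \<le> \<bar>q v x\<bar> * 1"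
        unfolding abs_mult by (intro mult_left_mono) auto
      then have "\<kappa> v * (\<bar>q v x * ((x \<bullet> v) * reg_inverse d v x)\<bar> * \<bar>v $ j\<bar>) \<le> \<kappa> v * (\<bar>q v x\<bar> * \<bar>v $ j\<bar>)"
        using nonneg[OF Rp_R[OF v]] by (intro mult_left_mono mult_right_mono) auto
      then show ?thesis
        using nonneg[OF Rp_R[OF v]] by (simp add: q[OF v] abs_mult mult.assoc)
    qed
    then have "\<bar>\<Sum>v\<in>Rp. \<kappa> v * ((u x - u (reflection v x)) * reg_inverse d v x) * v $ j\<bar> \<le> (\<Sum>v\<in>Rp. \<kappa> v * \<bar>q v x\<bar> * \<bar>v $ j\<bar>)"
      by (intro order_trans[OF sum_abs] sum_mono) auto
    then show ?thesis unfolding regularized_operator_def b_def by linarith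
  qed
  have bound: "\<bar>regularized_operator (e n) j u x * \<phi> x * weight (e n) x\<bar> \<le> B x" for n x
  proof (cases "norm x > r")
    case True
    then show ?thesis using supp[OF True, of "e n"] by (auto simp: B_def)
  next
    case False
    have "\<bar>regularized_operator (e n) j u x * \<phi> x * weight (e n) x\<bar> \<le> b x * \<bar>\<phi> x\<bar> * weight 1 x"
      unfolding abs_mult using regb[OF e(1), of n x] weight_mono[OF e(2) e(3), of n x] weight_nonneg[of "e n" x]
      by (intro mult_mono) (auto intro: mult_right_mono)
    then show ?thesis using False by (simp add: B_def)
  qed
  have lim: "(\<lambda>n. regularized_operator (e n) j u x * \<phi> x * weight (e n) x) \<longlonglongrightarrow> dunkl_operator Rp \<kappa> j u x * \<phi> x * weight 0 x"
    if x: "\<And>v. v \<in> R \<Longrightarrow> x \<bullet> v \<noteq> 0" for x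
  proof (intro tendsto_intros)
    show "(\<lambda>n. weight (e n) x) \<longlonglongrightarrow> weight 0 x"
      unfolding weight_def by (auto intro!: tendsto_eq_intros e0 simp: x)
    have "(\<lambda>n. (u x - u (reflection v x)) * reg_inverse (e n) v x) \<longlonglongrightarrow> q v x" if v: "v \<in> Rp" for v
    proof -
      have "(\<lambda>n. (u x - u (reflection v x)) * reg_inverse (e n) v x) \<longlonglongrightarrow> (u x - u (reflection v x)) * ((x \<bullet> v) / ((x \<bullet> v)\<^sup>2 + 0))"
        unfolding reg_inverse_def using x[OF Rp_R[OF v]] by (intro tendsto_intros e0) auto
      then show ?thesis using x[OF Rp_R[OF v]] by (simp add: q[OF v] power2_eq_square)
    qed
    then show "(\<lambda>n. regularized_operator (e n) j u x) \<longlonglongrightarrow> dunkl_operator Rp \<kappa> j u x"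
      unfolding regularized_operator_def dunkl_operator_def q_def by (intro tendsto_intros) auto
  qed
  have "(\<lambda>n. \<integral>x. regularized_operator (e n) j u x * \<phi> x * weight (e n) x \<partial>lborel)
    \<longlonglongrightarrow> (\<integral>x. dunkl_operator Rp \<kappa> j u x * \<phi> x * weight 0 x \<partial>lborel)"
  proof (rule integral_dominated_convergence)
    have "continuous_on UNIV (\<lambda>x. dunkl_operator Rp \<kappa> j u x * \<phi> x * weight 0 x)"
      by (intro continuous_intros continuous_dunkl_operator[OF u] \<phi> continuous_weight) auto
    then show "(\<lambda>x. dunkl_operator Rp \<kappa> j u x * \<phi> x * weight 0 x) \<in> borel_measurable lborel"
      using borel_measurable_continuous_onI by auto
    fix n
    have "continuous_on UNIV (\<lambda>x. regularized_operator (e n) j u x * \<phi> x * weight (e n) x)"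
      by (intro continuous_intros continuous_regularized[OF u] \<phi> continuous_weight e)
    then show "(\<lambda>x. regularized_operator (e n) j u x * \<phi> x * weight (e n) x) \<in> borel_measurable lborel"
      using borel_measurable_continuous_onI by auto
    show "AE x in lborel. norm (regularized_operator (e n) j u x * \<phi> x * weight (e n) x) \<le> B x"
      using bound by simp
  next
    have "continuous_on UNIV (\<lambda>x. b x * \<bar>\<phi> x\<bar> * weight 1 x)"
      by (intro continuous_intros bc \<phi> continuous_weight) auto
    then show "integrable lborel B"
      unfolding B_def by (intro borel_integrable_compact) (auto intro: continuous_on_subset)
    have "AE x in lborel. \<forall>v\<in>R. x \<bullet> v \<noteq> 0"
      by (intro AE_finite_allI finite_R AE_inner_neq_0 nonzero)
    then show "AE x in lborel. (\<lambda>n. regularized_operator (e n) j u x * \<phi> x * weight (e n) x) \<longlonglongrightarrow> dunkl_operator Rp \<kappa> j u x * \<phi> x * weight 0 x"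
      by eventually_elim (rule lim, auto)
  qed
  then show ?thesis by (simp add: e_def)
qed

lemma dunkl_operator_antisymmetric:
  assumes u: "has_cgrad u U" and g: "has_cgrad g G" and supp: "\<And>x. norm x > r \<Longrightarrow> g x = 0"
  shows "(\<integral>x. dunkl_operator Rp \<kappa> j u x * g x * weight 0 x \<partial>lborel) =
       - (\<integral>x. u x * dunkl_operator Rp \<kappa> j g x * weight 0 x \<partial>lborel)"
proof (rule LIMSEQ_unique)
  show "(\<lambda>n. \<integral>x. regularized_operator (1 / real (Suc n)) j u x * g x * weight (1 / real (Suc n)) x \<partial>lborel)
    \<longlonglongrightarrow> (\<integral>x. dunkl_operator Rp \<kappa> j u x * g x * weight 0 x \<partial>lborel)"
    by (rule regularized_limit[OF u has_cgrad_continuous[OF g], of r]) (simp add: supp)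
  have "(\<lambda>n. \<integral>x. regularized_operator (1 / real (Suc n)) j g x * u x * weight (1 / real (Suc n)) x \<partial>lborel)
    \<longlonglongrightarrow> (\<integral>x. dunkl_operator Rp \<kappa> j g x * u x * weight 0 x \<partial>lborel)"
    by (rule regularized_limit[OF g has_cgrad_continuous[OF u], of r]) (simp add: regularized_eq_0_outside[OF g supp])
  then have "(\<lambda>n. - (\<integral>x. u x * regularized_operator (1 / real (Suc n)) j g x * weight (1 / real (Suc n)) x \<partial>lborel))
    \<longlonglongrightarrow> - (\<integral>x. u x * dunkl_operator Rp \<kappa> j g x * weight 0 x \<partial>lborel)"
    by (intro tendsto_minus) (simp add: mult.commute)
  then show "(\<lambda>n. \<integral>x. regularized_operator (1 / real (Suc n)) j u x * g x * weight (1 / real (Suc n)) x \<partial>lborel)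
    \<longlonglongrightarrow> - (\<integral>x. u x * dunkl_operator Rp \<kappa> j g x * weight 0 x \<partial>lborel)"
    by (subst regularized_operator_antisymmetric[OF u g supp]) auto
qed

lemma has_cgrad_dunkl_operator:
  assumes f: "C2 f"
  obtains TF where "has_cgrad (dunkl_operator Rp \<kappa> j f) TF"
proof -
  define F where "F x = (\<chi> j. partial_deriv j f x)" for x
  have F: "has_cgrad f F"
    using f C1_iff_has_cgrad by (auto simp: C2_def F_def[abs_def])
  have pd: "\<exists>P. has_cgrad (partial_deriv j f) P" for j
    using f C1_iff_has_cgrad by (auto simp: C2_def)
  have "\<exists>P. has_cgrad (dunkl_quotient v f) P" if v: "v \<in> Rp" for v
  proof -
    obtain P where P: "\<And>j. has_cgrad (partial_deriv j f) (P j)" using pd by metis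
    have "(\<lambda>x. F x \<bullet> v) = (\<lambda>x. \<Sum>j\<in>UNIV. v $ j * partial_deriv j f x)"
      by (simp add: fun_eq_iff inner_vec_def F_def mult.commute)
    moreover have "has_cgrad (\<lambda>x. \<Sum>j\<in>UNIV. v $ j * partial_deriv j f x) (\<lambda>x. \<Sum>j\<in>UNIV. v $ j *\<^sub>R P j x)"
      by (intro has_cgrad_sum has_cgrad_cmult P) auto
    ultimately have "\<exists>K. has_cgrad (\<lambda>x. F x \<bullet> v) K" by auto
    then show ?thesis
      unfolding dunkl_quotient_C1(1)[OF F nonzero[OF Rp_R[OF v]]]
      using has_cgrad_cmult has_cgrad_integral_toward_reflection by blast
  qed
  then obtain Q where Q: "\<And>v. v \<in> Rp \<Longrightarrow> has_cgrad (dunkl_quotient v f) (Q v)" by metis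
  obtain P where "has_cgrad (partial_deriv j f) P" using pd by blast
  then have "has_cgrad (\<lambda>x. partial_deriv j f x + (\<Sum>v\<in>Rp. (\<kappa> v * v $ j) * dunkl_quotient v f x))
      (\<lambda>x. P x + (\<Sum>v\<in>Rp. (\<kappa> v * v $ j) *\<^sub>R Q v x))"
    by (intro has_cgrad_add has_cgrad_sum has_cgrad_cmult Q finite_Rp)
  then show thesis
    using that by (simp add: dunkl_operator_def[abs_def] mult_ac)
qed

lemma dunkl_laplacian_symmetric:
  assumes f: "C2 f" and g: "has_cgrad g G" and Tg: "\<And>j. has_cgrad (dunkl_operator Rp \<kappa> j g) (TG j)"
    and supp: "\<And>x. norm x > r \<Longrightarrow> g x = 0"
    and suppT: "\<And>j x. norm x > r \<Longrightarrow> dunkl_operator Rp \<kappa> j g x = 0"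
    and suppTT: "\<And>j x. norm x > r \<Longrightarrow> dunkl_operator Rp \<kappa> j (dunkl_operator Rp \<kappa> j g) x = 0"
  shows "(\<integral>x. dunkl_laplacian Rp \<kappa> f x * g x * weight 0 x \<partial>lborel) =
         (\<integral>x. f x * dunkl_laplacian Rp \<kappa> g x * weight 0 x \<partial>lborel)"
proof -
  let ?T = "dunkl_operator Rp \<kappa>"
  note w = continuous_weight[OF order_refl]
  have F: "has_cgrad f (\<lambda>x. \<chi> j. partial_deriv j f x)"
    using f C1_iff_has_cgrad by (auto simp: C2_def)
  have eq: "(\<integral>x. ?T j (?T j f) x * g x * weight 0 x \<partial>lborel) = (\<integral>x. f x * ?T j (?T j g) x * weight 0 x \<partial>lborel)"
    and int: "integrable lborel (\<lambda>x. ?T j (?T j f) x * g x * weight 0 x)"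
      "integrable lborel (\<lambda>x. f x * ?T j (?T j g) x * weight 0 x)" for j
  proof -
    obtain TF where TF: "has_cgrad (?T j f) TF" using has_cgrad_dunkl_operator[OF f] .
    show "(\<integral>x. ?T j (?T j f) x * g x * weight 0 x \<partial>lborel) = (\<integral>x. f x * ?T j (?T j g) x * weight 0 x \<partial>lborel)"
      using dunkl_operator_antisymmetric[OF TF g supp, of r j] dunkl_operator_antisymmetric[OF F Tg suppT, of r j j] by simp
    show "integrable lborel (\<lambda>x. ?T j (?T j f) x * g x * weight 0 x)"
      by (rule integrable_compact_support[of _ r])
        (auto simp: supp intro!: continuous_intros w continuous_dunkl_operator[OF TF] has_cgrad_continuous[OF g])
    show "integrable lborel (\<lambda>x. f x * ?T j (?T j g) x * weight 0 x)"
      by (rule integrable_compact_support[of _ r])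
        (auto simp: suppTT intro!: continuous_intros w continuous_dunkl_operator[OF Tg] has_cgrad_continuous[OF F])
  qed
  show ?thesis
    unfolding dunkl_laplacian_def sum_distrib_left sum_distrib_right
    by (simp add: int eq)
qed

section \<open>The Dunkl Laplacian of a test function\<close>


text \<open>The Leibniz rule fails for Dunkl operators in general, but an invariant factor can be pulled out
  of the difference quotient.\<close>
lemma dunkl_operator_product:
  assumes p: "has_cgrad p P" and b: "has_cgrad b B"
    and inv: "\<And>v x. v \<in> Rp \<Longrightarrow> b (reflection v x) = b x"
  shows "dunkl_operator Rp \<kappa> j (\<lambda>x. p x * b x) = (\<lambda>x. dunkl_operator Rp \<kappa> j p x * b x + p x * B x $ j)"
proof
  fix x
  have "dunkl_quotient v (\<lambda>x. p x * b x) = (\<lambda>x. dunkl_quotient v p x * b x)" if v: "v \<in> Rp" for v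
  proof (rule dunkl_quotient_eqI[OF nonzero[OF Rp_R[OF v]]])
    note * = dunkl_quotient_C1[OF p nonzero[OF Rp_R[OF v]]]
    show "continuous_on UNIV (\<lambda>x. dunkl_quotient v p x * b x)"
      using * by (intro continuous_intros has_cgrad_continuous[OF b]) simp
    show "p x * b x - p (reflection v x) * b (reflection v x) = dunkl_quotient v p x * b x * (x \<bullet> v)" for x
      unfolding inv[OF v] left_diff_distrib[symmetric] *(3)[of x] by (simp add: *(1))
  qed
  then show "dunkl_operator Rp \<kappa> j (\<lambda>x. p x * b x) x = dunkl_operator Rp \<kappa> j p x * b x + p x * B x $ j"
    unfolding dunkl_operator_def has_cgrad_partial_deriv[OF has_cgrad_mult[OF p b]] has_cgrad_partial_deriv[OF p]
    by (simp add: algebra_simps sum_distrib_left cong: sum.cong)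
qed

lemma dunkl_operator_add_cmult:
  assumes p: "has_cgrad p P" and b: "has_cgrad b B"
  shows "dunkl_operator Rp \<kappa> j (\<lambda>x. p x + c * b x) = (\<lambda>x. dunkl_operator Rp \<kappa> j p x + c * dunkl_operator Rp \<kappa> j b x)"
proof
  fix x
  have "dunkl_quotient v (\<lambda>x. p x + c * b x) = (\<lambda>x. dunkl_quotient v p x + c * dunkl_quotient v b x)" if v: "v \<in> Rp" for v
  proof (rule dunkl_quotient_eqI[OF nonzero[OF Rp_R[OF v]]])
    note * = dunkl_quotient_C1[OF p nonzero[OF Rp_R[OF v]]] dunkl_quotient_C1[OF b nonzero[OF Rp_R[OF v]]]
    show "continuous_on UNIV (\<lambda>x. dunkl_quotient v p x + c * dunkl_quotient v b x)"
      using * by (intro continuous_intros) simp_all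
    show "p x + c * b x - (p (reflection v x) + c * b (reflection v x)) =
        (dunkl_quotient v p x + c * dunkl_quotient v b x) * (x \<bullet> v)" for x
    proof -
      have "p x - p (reflection v x) = dunkl_quotient v p x * (x \<bullet> v)"
        using *(3)[of x] by (simp only: *(1))
      moreover have "b x - b (reflection v x) = dunkl_quotient v b x * (x \<bullet> v)"
        using *(6)[of x] by (simp only: *(4))
      ultimately show ?thesis by algebra
    qed
  qed
  then show "dunkl_operator Rp \<kappa> j (\<lambda>x. p x + c * b x) x = dunkl_operator Rp \<kappa> j p x + c * dunkl_operator Rp \<kappa> j b x"
    unfolding dunkl_operator_def has_cgrad_partial_deriv[OF has_cgrad_add[OF p has_cgrad_cmult[OF b]]]
      has_cgrad_partial_deriv[OF p] has_cgrad_partial_deriv[OF b]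
    by (simp add: algebra_simps sum_distrib_left sum.distrib cong: sum.cong)
qed

lemma hompoly_pred_dunkl_operator:
  assumes "hompoly m p"
  shows "hompoly_pred m (dunkl_operator Rp \<kappa> j p)"
proof -
  obtain P where P: "has_cgrad p P" "\<And>j. hompoly_pred m (\<lambda>x. P x $ j)"
    using hompoly_gradient[OF assms] by blast
  have "hompoly_pred m (dunkl_quotient v p)" if v: "v \<in> Rp" for v
  proof -
    obtain q where "\<And>x. p x - p (reflection v x) = q x * (x \<bullet> v)" "hompoly_pred m q"
      using hompoly_quotient[OF nonzero[OF Rp_R[OF v]] assms] by blast
    then show ?thesis
      using dunkl_quotient_eqI[OF nonzero[OF Rp_R[OF v]], of q p] hompoly_pred_continuous by metis
  qed
  then have "hompoly_pred m (\<lambda>x. P x $ j + (\<Sum>v\<in>Rp. (\<kappa> v * v $ j) * dunkl_quotient v p x))"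
    by (intro hompoly_pred_add P hompoly_pred_sum finite_Rp hompoly_pred_cmult)
  then show ?thesis
    by (simp add: dunkl_operator_def[abs_def] has_cgrad_partial_deriv[OF P(1)] mult_ac)
qed

lemma dunkl_operator_0: "dunkl_operator Rp \<kappa> j (\<lambda>x. 0) = (\<lambda>x. 0)"
  using hompoly_pred_dunkl_operator[OF hompoly.const[of 0]] by simp

lemma dunkl_laplacian_const: "dunkl_laplacian Rp \<kappa> (\<lambda>x. c) = (\<lambda>x. 0)"
  using hompoly_pred_dunkl_operator[OF hompoly.const[of c]] by (simp add: dunkl_laplacian_def[abs_def] dunkl_operator_0)

lemma hompoly_dunkl_laplacian_0:
  assumes "hompoly 0 p"
  shows "dunkl_laplacian Rp \<kappa> p = (\<lambda>x. 0)"
  using hompoly_pred_dunkl_operator[OF assms] by (simp add: dunkl_laplacian_def[abs_def] dunkl_operator_0)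

lemma hompoly_dunkl_laplacian_Suc:
  assumes "hompoly (Suc m) p"
  shows "\<exists>k\<le>m. hompoly k (dunkl_laplacian Rp \<kappa> p)"
proof -
  have "hompoly_pred m (dunkl_operator Rp \<kappa> j (dunkl_operator Rp \<kappa> j p))" for j
    using hompoly_pred_dunkl_operator[OF assms] by (intro hompoly_pred_dunkl_operator) simp
  then have "hompoly_pred m (\<lambda>x. \<Sum>j\<in>UNIV. dunkl_operator Rp \<kappa> j (dunkl_operator Rp \<kappa> j p) x)"
    by (intro hompoly_pred_sum) auto
  then have "hompoly_pred m (dunkl_laplacian Rp \<kappa> p)"
    by (simp add: dunkl_laplacian_def[abs_def])
  then show ?thesis
  proof (cases m)
    case 0
    with \<open>hompoly_pred m (dunkl_laplacian Rp \<kappa> p)\<close> have "hompoly 0 (dunkl_laplacian Rp \<kappa> p)"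
      by (simp add: hompoly.zero)
    then show ?thesis by auto
  next
    case (Suc l)
    with \<open>hompoly_pred m (dunkl_laplacian Rp \<kappa> p)\<close> show ?thesis
      by (intro exI[of _ l]) simp
  qed
qed

text \<open>The exponent with which the weighted volume of a ball grows in its radius.\<close>
definition homogeneous_dim :: real where
  "homogeneous_dim = real CARD('n) + 2 * (\<Sum>v\<in>Rp. \<kappa> v)"

text \<open>The radial factor of a test function produces these two sums. In the first one the reflected values
  of \<open>p\<close> enter with a plus sign, in the second one with a minus sign, so only the Euler
  field and a multiple of \<open>p\<close> survive.\<close>
lemma sum_dunkl_operator_coord:
  assumes p: "has_cgrad p P" and euler: "\<And>x. x \<bullet> P x = m * p x"
  shows "(\<Sum>j\<in>UNIV. dunkl_operator Rp \<kappa> j (\<lambda>x. x $ j * p x) x) + (\<Sum>j\<in>UNIV. x $ j * dunkl_operator Rp \<kappa> j p x)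
    = (homogeneous_dim + 2 * m) * p x"
proof -
  define q where "q v = dunkl_quotient v p" for v
  have qc: "continuous_on UNIV (q v)" and q: "p x - p (reflection v x) = q v x * (x \<bullet> v)" if "v \<in> Rp" for v x
    using dunkl_quotient_C1[OF p nonzero[OF Rp_R[OF that]]] by (simp_all add: q_def)
  have quot: "dunkl_quotient v (\<lambda>x. x $ j * p x) = (\<lambda>x. x $ j * q v x + (2 * v $ j / (v \<bullet> v)) * p (reflection v x))"
    if v: "v \<in> Rp" for v j
  proof (rule dunkl_quotient_eqI[OF nonzero[OF Rp_R[OF v]]])
    show "continuous_on UNIV (\<lambda>x. x $ j * q v x + (2 * v $ j / (v \<bullet> v)) * p (reflection v x))"
      by (intro continuous_intros qc v continuous_on_comp_reflection has_cgrad_continuous[OF p])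
    show "x $ j * p x - reflection v x $ j * p (reflection v x) =
      (x $ j * q v x + (2 * v $ j / (v \<bullet> v)) * p (reflection v x)) * (x \<bullet> v)" for x
    proof -
      define c where "c = (x \<bullet> v) / (v \<bullet> v)"
      have "reflection v x $ j = x $ j - 2 * c * v $ j"
        by (simp add: reflection_eq c_def)
      then have "x $ j * p x - reflection v x $ j * p (reflection v x) =
         x $ j * (p x - p (reflection v x)) + 2 * c * v $ j * p (reflection v x)"
        by (simp only: left_diff_distrib right_diff_distrib)
      also have "\<dots> = (x $ j * q v x + (2 * v $ j / (v \<bullet> v)) * p (reflection v x)) * (x \<bullet> v)"
        by (simp add: q[OF v] c_def distrib_right)
      finally show ?thesis .
    qed
  qed
  have T1: "dunkl_operator Rp \<kappa> j (\<lambda>x. x $ j * p x) x = p x + x $ j * P x $ j +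
      (\<Sum>v\<in>Rp. \<kappa> v * (x $ j * q v x + (2 * v $ j / (v \<bullet> v)) * p (reflection v x)) * v $ j)" for j
    unfolding dunkl_operator_def has_cgrad_partial_deriv[OF has_cgrad_mult[OF has_cgrad_nth p]]
    by (simp add: quot cong: sum.cong)
  have T2: "x $ j * dunkl_operator Rp \<kappa> j p x = x $ j * P x $ j + (\<Sum>v\<in>Rp. \<kappa> v * q v x * (x $ j * v $ j))" for j
    unfolding dunkl_operator_def has_cgrad_partial_deriv[OF p] q_def
    by (simp add: distrib_left sum_distrib_left mult_ac)
  have A1: "(\<Sum>j\<in>UNIV. \<Sum>v\<in>Rp. \<kappa> v * (x $ j * q v x + (2 * v $ j / (v \<bullet> v)) * p (reflection v x)) * v $ j)
      = (\<Sum>v\<in>Rp. \<kappa> v * (p x + p (reflection v x)))"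
  proof (subst sum.swap, rule sum.cong[OF refl])
    fix v assume v: "v \<in> Rp"
    have "(\<Sum>j\<in>UNIV. \<kappa> v * (x $ j * q v x + (2 * v $ j / (v \<bullet> v)) * p (reflection v x)) * v $ j)
      = (\<Sum>j\<in>UNIV. \<kappa> v * q v x * (x $ j * v $ j) + (\<kappa> v * 2 / (v \<bullet> v) * p (reflection v x)) * (v $ j * v $ j))"
      by (rule sum.cong) (simp_all add: algebra_simps)
    also have "\<dots> = \<kappa> v * q v x * (x \<bullet> v) + (\<kappa> v * 2 / (v \<bullet> v) * p (reflection v x)) * (v \<bullet> v)"
      by (simp only: sum.distrib sum_distrib_left[symmetric] inner_vec_def inner_real_def)
    also have "\<dots> = \<kappa> v * (p x + p (reflection v x))"
      using q[OF v, of x] nonzero[OF Rp_R[OF v]] by (simp add: mult.assoc) (simp add: algebra_simps)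
    finally show "(\<Sum>j\<in>UNIV. \<kappa> v * (x $ j * q v x + (2 * v $ j / (v \<bullet> v)) * p (reflection v x)) * v $ j)
      = \<kappa> v * (p x + p (reflection v x))" .
  qed
  have A2: "(\<Sum>j\<in>UNIV. \<Sum>v\<in>Rp. \<kappa> v * q v x * (x $ j * v $ j)) = (\<Sum>v\<in>Rp. \<kappa> v * (p x - p (reflection v x)))"
  proof (subst sum.swap, rule sum.cong[OF refl])
    fix v assume v: "v \<in> Rp"
    have "(\<Sum>j\<in>UNIV. x $ j * v $ j) = x \<bullet> v" by (simp add: inner_vec_def)
    then show "(\<Sum>j\<in>UNIV. \<kappa> v * q v x * (x $ j * v $ j)) = \<kappa> v * (p x - p (reflection v x))"
      by (simp add: sum_distrib_left[symmetric] q[OF v])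
  qed
  have E: "(\<Sum>j\<in>UNIV. x $ j * P x $ j) = m * p x"
    using euler[of x] by (simp add: inner_vec_def)
  have "(\<Sum>v\<in>Rp. \<kappa> v * (p x + p (reflection v x))) + (\<Sum>v\<in>Rp. \<kappa> v * (p x - p (reflection v x))) = 2 * (\<Sum>v\<in>Rp. \<kappa> v) * p x"
    by (simp add: sum.distrib[symmetric] sum_distrib_left sum_distrib_right algebra_simps)
  then show ?thesis
    unfolding T1 T2 sum.distrib A1 A2 E homogeneous_dim_def by (simp add: algebra_simps)
qed

text \<open>The term with \<open>x \<bullet> x\<close> that the chain rule produces is absorbed by
  \<open>(x \<bullet> x) * bump (k + 1) s x = s * bump (k + 1) s x - bump (k + 2) s x\<close>. The smallest exponent is \<open>k + 3\<close>
  because two Dunkl operators must be applied and the result must still be continuous.\<close>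
lemma dunkl_laplacian_hompoly_bump:
  fixes s :: real and k :: nat
  assumes p: "hompoly m p"
  defines "g \<equiv> (\<lambda>x. p x * bump (k + 3) s x)"
  shows "dunkl_laplacian Rp \<kappa> g x = dunkl_laplacian Rp \<kappa> p x * bump (k + 3) s x
     - 2 * real (k + 3) * (homogeneous_dim + 2 * real m + 2 * real (k + 2)) * (p x * bump (k + 2) s x)
     + 4 * real (k + 3) * real (k + 2) * s * (p x * bump (k + 1) s x)" (is "?lap")
   and "\<exists>G. has_cgrad g G" and "\<exists>G. has_cgrad (dunkl_operator Rp \<kappa> j g) G"
   and "norm x > r \<Longrightarrow> s \<le> r\<^sup>2 \<Longrightarrow> r \<ge> 0 \<Longrightarrow> dunkl_operator Rp \<kappa> j g x = 0"
   and "norm x > r \<Longrightarrow> s \<le> r\<^sup>2 \<Longrightarrow> r \<ge> 0 \<Longrightarrow> dunkl_operator Rp \<kappa> j (dunkl_operator Rp \<kappa> j g) x = 0"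
proof -
  let ?T = "dunkl_operator Rp \<kappa>"
  have nums: "k + 3 = Suc (Suc (Suc k))" "k + 2 = Suc (Suc k)" "k + 1 = Suc k" by simp_all
  obtain P where P: "has_cgrad p P" "\<And>x. x \<bullet> P x = real m * p x"
    using hompoly_gradient[OF p] by blast
  have Tp: "hompoly_pred m (?T j p)" for j by (rule hompoly_pred_dunkl_operator[OF p])
  have "\<exists>Q. has_cgrad (?T j p) Q" for j
    using Tp[of j] has_cgrad_const by (cases m) (auto dest: hompoly_gradient)
  then obtain Q where Q: "\<And>j. has_cgrad (?T j p) (Q j)" by metis
  define c where "c = - 2 * real (k + 3)"
  define d where "d = - 2 * real (k + 2)"
  have B3: "has_cgrad (bump (k + 3) s) (\<lambda>x::real^'n. (c * bump (k + 2) s x) *\<^sub>R x)"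
    unfolding nums c_def by (rule has_cgrad_bump)
  have B2: "has_cgrad (bump (k + 2) s) (\<lambda>x::real^'n. (d * bump (k + 1) s x) *\<^sub>R x)"
    unfolding nums d_def by (rule has_cgrad_bump)
  have prod3: "?T j (\<lambda>x. f x * bump (k + 3) s x) = (\<lambda>x. ?T j f x * bump (k + 3) s x + f x * ((c * bump (k + 2) s x) *\<^sub>R x) $ j)"
    if "has_cgrad f F" for f F j
    by (rule dunkl_operator_product[OF that B3]) (rule bump_reflection[OF nonzero[OF Rp_R]])
  have prod2: "?T j (\<lambda>x. f x * bump (k + 2) s x) = (\<lambda>x. ?T j f x * bump (k + 2) s x + f x * ((d * bump (k + 1) s x) *\<^sub>R x) $ j)"
    if "has_cgrad f F" for f F j
    by (rule dunkl_operator_product[OF that B2]) (rule bump_reflection[OF nonzero[OF Rp_R]])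
  have X: "has_cgrad (\<lambda>x. x $ j * p x) (\<lambda>x. x $ j *\<^sub>R P x + p x *\<^sub>R axis j 1)" for j
    by (rule has_cgrad_mult[OF has_cgrad_nth P(1)])
  have Tg: "?T j g = (\<lambda>x. ?T j p x * bump (k + 3) s x + c * ((x $ j * p x) * bump (k + 2) s x))" for j
    unfolding g_def by (subst prod3[OF P(1)]) (simp add: mult_ac)
  have TTg: "?T j (?T j g) = (\<lambda>x. ?T j (?T j p) x * bump (k + 3) s x + ?T j p x * (c * bump (k + 2) s x) * x $ j +
       c * (?T j (\<lambda>x. x $ j * p x) x * bump (k + 2) s x + (x $ j * p x) * (d * bump (k + 1) s x) * x $ j))" for j
    unfolding Tg dunkl_operator_add_cmult[OF has_cgrad_mult[OF Q B3] has_cgrad_mult[OF X B2]]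
      prod3[OF Q] prod2[OF X]
    by (simp add: mult_ac)
  show "\<exists>G. has_cgrad g G" unfolding g_def using has_cgrad_mult[OF P(1) B3] by blast
  show "\<exists>G. has_cgrad (?T j g) G" for j
    unfolding Tg using has_cgrad_add[OF has_cgrad_mult[OF Q B3] has_cgrad_cmult[OF has_cgrad_mult[OF X B2]]] by blast
  have b0: "bump (k + 3) s x = 0" "bump (k + 2) s x = 0" "bump (k + 1) s x = 0"
    if "norm x > r" "s \<le> r\<^sup>2" "r \<ge> 0" for x :: "real^'n"
    unfolding nums using bump_eq_0[OF that(2,1,3)] by auto
  show "?T j g x = 0" if "norm x > r" "s \<le> r\<^sup>2" "r \<ge> 0" for j
    unfolding Tg using b0[OF that] by simp
  show "?T j (?T j g) x = 0" if "norm x > r" "s \<le> r\<^sup>2" "r \<ge> 0" for j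
    unfolding TTg using b0[OF that] by simp
  have "dunkl_laplacian Rp \<kappa> g x = dunkl_laplacian Rp \<kappa> p x * bump (k + 3) s x
    + c * bump (k + 2) s x * ((\<Sum>j\<in>UNIV. ?T j (\<lambda>x. x $ j * p x) x) + (\<Sum>j\<in>UNIV. x $ j * ?T j p x))
    + c * d * p x * bump (k + 1) s x * (\<Sum>j\<in>UNIV. x $ j * x $ j)"
    unfolding dunkl_laplacian_def TTg
    by (simp add: sum.distrib sum_distrib_left sum_distrib_right algebra_simps)
  also have "(\<Sum>j\<in>UNIV. x $ j * x $ j) = x \<bullet> x" by (simp add: inner_vec_def)
  also have "(\<Sum>j\<in>UNIV. ?T j (\<lambda>x. x $ j * p x) x) + (\<Sum>j\<in>UNIV. x $ j * ?T j p x) = (homogeneous_dim + 2 * real m) * p x"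
    by (rule sum_dunkl_operator_coord[OF P])
  finally have "dunkl_laplacian Rp \<kappa> g x = dunkl_laplacian Rp \<kappa> p x * bump (k + 3) s x
    + c * (homogeneous_dim + 2 * real m) * p x * bump (k + 2) s x + c * d * p x * ((x \<bullet> x) * bump (k + 1) s x)"
    by (simp add: mult_ac)
  also have "(x \<bullet> x) * bump (k + 1) s x = s * bump (k + 1) s x - bump (k + 2) s x"
    unfolding nums bump_Suc by (simp add: algebra_simps)
  finally show ?lap unfolding c_def d_def by (simp add: algebra_simps)
qed


section \<open>Radial moments of weakly harmonic functions\<close>

definition moment :: "(real^'n \<Rightarrow> real) \<Rightarrow> nat \<Rightarrow> real \<Rightarrow> real" where
  "moment F k s = (\<integral>x. F x * bump k s x * weight 0 x \<partial>lborel)"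

lemma continuous_moment_integrand:
  "continuous_on UNIV F \<Longrightarrow> continuous_on UNIV (\<lambda>x. F x * bump k s x * weight 0 x)"
  by (intro continuous_intros continuous_bump continuous_weight) auto

lemma integrable_moment:
  assumes "continuous_on UNIV F"
  shows "integrable lborel (\<lambda>x. F x * bump (Suc k) s x * weight 0 x)"
proof (rule integrable_compact_support[of _ "sqrt \<bar>s\<bar>"])
  show "continuous_on UNIV (\<lambda>x. F x * bump (Suc k) s x * weight 0 x)"
    by (rule continuous_moment_integrand[OF assms])
  show "F x * bump (Suc k) s x * weight 0 x = 0" if "norm x > sqrt \<bar>s\<bar>" for x
    using bump_eq_0[of s "sqrt \<bar>s\<bar>" x k] that by simp
qed

lemma moment_add:
  assumes "continuous_on UNIV F" "continuous_on UNIV G"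
  shows "moment (\<lambda>x. F x + G x) (Suc k) s = moment F (Suc k) s + moment G (Suc k) s"
  unfolding moment_def distrib_right by (simp add: integrable_moment assms)

lemma moment_cmult: "moment (\<lambda>x. c * F x) k s = c * moment F k s"
  unfolding moment_def by (simp add: mult.assoc)

lemma moment_abs_le:
  assumes F: "continuous_on UNIV F" and G: "continuous_on UNIV G"
    and le: "\<And>x. norm x \<le> sqrt s \<Longrightarrow> \<bar>F x\<bar> \<le> G x" and s: "s \<ge> 0"
  shows "\<bar>moment F (Suc k) s\<bar> \<le> moment G (Suc k) s"
proof -
  have "\<bar>moment F (Suc k) s\<bar> \<le> (\<integral>x. \<bar>F x * bump (Suc k) s x * weight 0 x\<bar> \<partial>lborel)"
    unfolding moment_def by (rule integral_abs_bound)
  also have "\<dots> \<le> moment G (Suc k) s"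
    unfolding moment_def
  proof (rule integral_mono)
    fix x
    show "\<bar>F x * bump (Suc k) s x * weight 0 x\<bar> \<le> G x * bump (Suc k) s x * weight 0 x"
    proof (cases "norm x \<le> sqrt s")
      case True
      then show ?thesis
        using le[OF True] weight_nonneg[of 0 x] bump_nonneg[of "Suc k" s x]
        by (simp add: abs_mult mult_right_mono)
    next
      case False
      then have "bump (Suc k) s x = 0" using s by (intro bump_eq_0[of s "sqrt s"]) auto
      then show ?thesis by simp
    qed
  qed (auto intro!: integrable_moment F G)
  finally show ?thesis .
qed

lemma moment_derivative:
  assumes F: "continuous_on UNIV F"
  shows "((\<lambda>s. moment F (k + 2) s) has_real_derivative real (k + 2) * moment F (k + 1) s0) (at s0)"
proof -
  (* One box contains the supports for all s within distance 1 of s0, so that the integral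
     over a fixed compact set can be differentiated. *)
  define r where "r = sqrt (\<bar>s0\<bar> + 1)"
  obtain a :: "real^'n" where a: "cball 0 r \<subseteq> cbox (-a) a"
    using bounded_subset_cbox_symmetric[OF bounded_cball] by blast
  define U where "U = {s0 - 1 <..< s0 + 1}"
  have r: "r\<^sup>2 = \<bar>s0\<bar> + 1" "r \<ge> 0" by (auto simp: r_def)
  have mom: "((\<lambda>x. F x * bump (Suc l) s x * weight 0 x) has_integral moment F (Suc l) s) (cbox (-a) a)"
    if s: "s \<in> U" for s l
    unfolding moment_def
  proof (rule has_integral_lborel_superset[OF integrable_moment[OF F]])
    fix x assume "x \<notin> cbox (-a) a"
    then have "norm x > r" using a by (force simp: not_le[symmetric])
    then have "bump (Suc l) s x = 0"
      using s r by (intro bump_eq_0[of s r]) (auto simp: U_def)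
    then show "F x * bump (Suc l) s x * weight 0 x = 0" by simp
  qed
  have s0: "s0 \<in> U" and opU: "open U" by (auto simp: U_def)
  have "((\<lambda>s. integral (cbox (-a) a) (\<lambda>x. F x * bump (k + 2) s x * weight 0 x)) has_field_derivative
     integral (cbox (-a) a) (\<lambda>x. real (k + 2) * (F x * bump (k + 1) s0 x * weight 0 x))) (at s0 within U)"
  proof (rule leibniz_rule_field_derivative[where fx = "\<lambda>s x. real (k + 2) * (F x * bump (k + 1) s x * weight 0 x)"])
    fix s and x :: "real^'n"
    have "((\<lambda>s. s - x \<bullet> x) has_real_derivative 1) (at s)"
      by (auto intro!: derivative_eq_intros)
    from DERIV_chain2[OF DERIV_max_power this, of k]
    have "((\<lambda>s. bump (k + 2) s x) has_real_derivative real (k + 2) * bump (k + 1) s x) (at s)"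
      by (simp add: bump_def)
    from has_field_derivative_at_within[OF DERIV_cmult[OF this, of "F x * weight 0 x"], of U]
    show "((\<lambda>s. F x * bump (k + 2) s x * weight 0 x) has_field_derivative
        real (k + 2) * (F x * bump (k + 1) s x * weight 0 x)) (at s within U)"
      by (simp add: mult_ac)
  next
    show "(\<lambda>x. F x * bump (k + 2) s x * weight 0 x) integrable_on cbox (- a) a" for s
      by (rule integrable_continuous) (rule continuous_on_subset[OF continuous_moment_integrand[OF F]], simp)
    show "continuous_on (U \<times> cbox (- a) a) (\<lambda>(s, x). real (k + 2) * (F x * bump (k + 1) s x * weight 0 x))"
      unfolding bump_def split_beta
      by (intro continuous_intros continuous_on_compose2[OF F] continuous_on_compose2[OF continuous_weight[OF order_refl]]) auto
    show "convex U" by (simp add: U_def)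
  qed (rule s0)
  moreover have "integral (cbox (-a) a) (\<lambda>x. real (k + 2) * (F x * bump (k + 1) s0 x * weight 0 x)) = real (k + 2) * moment F (k + 1) s0"
    using mom[OF s0, of k] by (simp add: integral_unique)
  ultimately have "((\<lambda>s. integral (cbox (-a) a) (\<lambda>x. F x * bump (k + 2) s x * weight 0 x)) has_field_derivative
     real (k + 2) * moment F (k + 1) s0) (at s0)"
    using at_within_open[OF s0 opU] by simp
  then show ?thesis
  proof (rule has_field_derivative_transform_within_open[OF _ opU s0])
    show "integral (cbox (-a) a) (\<lambda>x. F x * bump (k + 2) s x * weight 0 x) = moment F (k + 2) s" if "s \<in> U" for s
      using mom[OF that, of "Suc k"] by (simp add: integral_unique)
  qed
qed

text \<open>By \<open>moment_derivative\<close> the hypothesis is the Euler equation \<open>s * M' s = b * M s\<close> for the moment \<open>M\<close>.\<close>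
lemma moment_eq_powr:
  assumes F: "continuous_on UNIV F"
    and ode: "\<And>s. s > 0 \<Longrightarrow> b * moment F (k + 2) s = real (k + 2) * s * moment F (k + 1) s"
  shows "\<exists>C. \<forall>s>0. moment F (k + 2) s = C * s powr b"
proof -
  have "\<exists>C. \<forall>s\<in>{0<..}. moment F (k + 2) s * s powr (- b) = C"
  proof (rule has_field_derivative_zero_constant)
    fix s :: real assume "s \<in> {0<..}"
    then have s: "s > 0" by simp
    have "((\<lambda>s. s powr (- b)) has_real_derivative (- b) * s powr (- b - 1)) (at s)"
      by (rule has_real_derivative_powr[OF s])
    from DERIV_mult[OF moment_derivative[OF F, of k s] this]
    have "((\<lambda>s. moment F (k + 2) s * s powr (- b)) has_real_derivative
       real (k + 2) * moment F (k + 1) s * s powr (- b) + (- b) * s powr (- b - 1) * moment F (k + 2) s) (at s)" .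
    moreover have "real (k + 2) * moment F (k + 1) s * s powr (- b) + (- b) * s powr (- b - 1) * moment F (k + 2) s
       = s powr (- b - 1) * (real (k + 2) * s * moment F (k + 1) s - b * moment F (k + 2) s)"
    proof -
      have "s powr (- b) = s powr (- b - 1) * s"
        using s by (simp add: powr_diff)
      then show ?thesis by (simp only:) (simp add: algebra_simps)
    qed
    ultimately show "((\<lambda>s. moment F (k + 2) s * s powr (- b)) has_field_derivative 0) (at s within {0<..})"
      using ode[OF s] by (simp add: has_field_derivative_at_within)
  qed simp
  then obtain C where C: "\<And>s. s > 0 \<Longrightarrow> moment F (k + 2) s * s powr (- b) = C" by auto
  have "moment F (k + 2) s = C * s powr b" if "s > 0" for s
  proof -
    have "s powr (- b) * s powr b = 1" using that by (simp add: powr_add[symmetric])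
    then show ?thesis using C[OF that] by (metis mult.assoc mult.right_neutral)
  qed
  then show ?thesis by blast
qed

text \<open>Orthogonality to the Dunkl Laplacians of the test functions, written out in moments. As a
  condition on \<open>u\<close> it is linear and free of derivatives, so that \<open>h\<close> may be replaced by \<open>h - h 0\<close>.\<close>
definition weakly_harmonic :: "(real^'n \<Rightarrow> real) \<Rightarrow> bool" where
  "weakly_harmonic u \<longleftrightarrow> continuous_on UNIV u \<and> (\<forall>m p k s. hompoly m p \<longrightarrow> s > 0 \<longrightarrow>
     moment (\<lambda>x. u x * dunkl_laplacian Rp \<kappa> p x) (k + 3) s
     - 2 * real (k + 3) * (homogeneous_dim + 2 * real m + 2 * real (k + 2)) * moment (\<lambda>x. u x * p x) (k + 2) s
     + 4 * real (k + 3) * real (k + 2) * s * moment (\<lambda>x. u x * p x) (k + 1) s = 0)"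

lemma continuous_dunkl_laplacian_hompoly:
  assumes "hompoly m p" shows "continuous_on UNIV (dunkl_laplacian Rp \<kappa> p)"
proof (cases m)
  case 0
  then show ?thesis using hompoly_dunkl_laplacian_0 assms by simp
next
  case (Suc k)
  then show ?thesis using hompoly_dunkl_laplacian_Suc[of k p] assms hompoly_continuous by blast
qed

lemma harmonic_imp_weakly_harmonic:
  assumes f: "C2 f" and harm: "\<And>x. dunkl_laplacian Rp \<kappa> f x = 0"
  shows "weakly_harmonic f"
  unfolding weakly_harmonic_def
proof (intro conjI allI impI)
  show fc: "continuous_on UNIV f"
    using f C1_iff_has_cgrad has_cgrad_continuous by (auto simp: C2_def)
  fix m k and s :: real and p :: "real^'n \<Rightarrow> real"
  assume p: "hompoly m p" and s: "s > 0"
  define g where "g = (\<lambda>x. p x * bump (k + 3) s x)"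
  note G = dunkl_laplacian_hompoly_bump[OF p, where k = k and s = s, folded g_def]
  obtain G where G1: "has_cgrad g G" using G(2) by blast
  obtain TG where TG: "\<And>j. has_cgrad (dunkl_operator Rp \<kappa> j g) (TG j)" using G(3) by metis
  have r: "s \<le> (sqrt s)\<^sup>2" "sqrt s \<ge> 0" using s by auto
  have supp: "g x = 0" if "norm x > sqrt s" for x
    using bump_eq_0[OF r(1) that r(2), of "k + 2"] by (simp add: g_def numeral_3_eq_3)
  have "(\<integral>x. f x * dunkl_laplacian Rp \<kappa> g x * weight 0 x \<partial>lborel) = 0"
    using dunkl_laplacian_symmetric[OF f G1 TG supp G(4)[OF _ r] G(5)[OF _ r]] by (simp add: harm)
  moreover have "f x * dunkl_laplacian Rp \<kappa> g x * weight 0 x =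
     (f x * dunkl_laplacian Rp \<kappa> p x) * bump (Suc (k + 2)) s x * weight 0 x
     - 2 * real (k + 3) * (homogeneous_dim + 2 * real m + 2 * real (k + 2)) * ((f x * p x) * bump (Suc (k + 1)) s x * weight 0 x)
     + 4 * real (k + 3) * real (k + 2) * s * ((f x * p x) * bump (Suc k) s x * weight 0 x)" for x
  proof -
    have "k + 3 = Suc (k + 2)" "k + 2 = Suc (k + 1)" "k + 1 = Suc k" by simp_all
    then show ?thesis unfolding G(1) by (simp only: distrib_left distrib_right left_diff_distrib right_diff_distrib) (simp only: mult_ac)
  qed
  ultimately have int0: "(\<integral>x. (f x * dunkl_laplacian Rp \<kappa> p x) * bump (Suc (k + 2)) s x * weight 0 x
     - 2 * real (k + 3) * (homogeneous_dim + 2 * real m + 2 * real (k + 2)) * ((f x * p x) * bump (Suc (k + 1)) s x * weight 0 x)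
     + 4 * real (k + 3) * real (k + 2) * s * ((f x * p x) * bump (Suc k) s x * weight 0 x) \<partial>lborel) = 0"
    by (simp only:)
  have c: "continuous_on UNIV (\<lambda>x. f x * p x)" "continuous_on UNIV (\<lambda>x. f x * dunkl_laplacian Rp \<kappa> p x)"
    by (intro continuous_intros fc hompoly_continuous[OF p] continuous_dunkl_laplacian_hompoly[OF p])+
  have split: "(\<integral>x. A x - a * B x + b * D x \<partial>lborel) = (\<integral>x. A x \<partial>lborel) - a * (\<integral>x. B x \<partial>lborel) + b * (\<integral>x. D x \<partial>lborel)"
    if "integrable lborel A" "integrable lborel B" "integrable lborel D" for A B D :: "real^'n \<Rightarrow> real" and a b
    using that by simp
  have "(\<integral>x. (f x * dunkl_laplacian Rp \<kappa> p x) * bump (Suc (k + 2)) s x * weight 0 x \<partial>lborel)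
     - 2 * real (k + 3) * (homogeneous_dim + 2 * real m + 2 * real (k + 2)) * (\<integral>x. (f x * p x) * bump (Suc (k + 1)) s x * weight 0 x \<partial>lborel)
     + 4 * real (k + 3) * real (k + 2) * s * (\<integral>x. (f x * p x) * bump (Suc k) s x * weight 0 x \<partial>lborel) = 0"
    using int0 unfolding split[OF integrable_moment[OF c(2)] integrable_moment[OF c(1)] integrable_moment[OF c(1)]] .
  then show "moment (\<lambda>x. f x * dunkl_laplacian Rp \<kappa> p x) (k + 3) s
     - 2 * real (k + 3) * (homogeneous_dim + 2 * real m + 2 * real (k + 2)) * moment (\<lambda>x. f x * p x) (k + 2) s
     + 4 * real (k + 3) * real (k + 2) * s * moment (\<lambda>x. f x * p x) (k + 1) s = 0"
    unfolding moment_def by (simp add: numeral_3_eq_3)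
qed

lemma weakly_harmonic_1: "weakly_harmonic (\<lambda>x. 1)"
proof (rule harmonic_imp_weakly_harmonic)
  have c: "C1 (\<lambda>x::real^'n. c)" for c
    unfolding C1_iff_has_cgrad using has_cgrad_const[of c]
    by (simp add: has_cgrad_partial_deriv[OF has_cgrad_const] has_cgrad_def zero_vec_def)
  have "partial_deriv j (\<lambda>x::real^'n. 1) = (\<lambda>x. 0)" for j
    using has_cgrad_partial_deriv[OF has_cgrad_const] by (auto simp: fun_eq_iff)
  then show "C2 (\<lambda>x::real^'n. 1)" by (simp add: C2_def c)
qed (simp add: dunkl_laplacian_const)

lemma weakly_harmonic_affine:
  assumes u: "weakly_harmonic u"
  shows "weakly_harmonic (\<lambda>x. a * u x + c)"
  unfolding weakly_harmonic_def
proof (intro conjI allI impI)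
  have uc: "continuous_on UNIV u" using u by (simp add: weakly_harmonic_def)
  show "continuous_on UNIV (\<lambda>x. a * u x + c)" by (intro continuous_intros uc)
  fix m k and s :: real and p :: "real^'n \<Rightarrow> real"
  assume p: "hompoly m p" and s: "s > 0"
  have lin: "moment (\<lambda>x. (a * u x + c) * q x) (Suc l) s = a * moment (\<lambda>x. u x * q x) (Suc l) s + c * moment (\<lambda>x. 1 * q x) (Suc l) s"
    if q: "continuous_on UNIV q" for q l
  proof -
    have "moment (\<lambda>x. (a * u x + c) * q x) (Suc l) s = moment (\<lambda>x. a * (u x * q x) + c * (1 * q x)) (Suc l) s"
      by (simp add: algebra_simps)
    also have "\<dots> = a * moment (\<lambda>x. u x * q x) (Suc l) s + c * moment (\<lambda>x. 1 * q x) (Suc l) s"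
      by (subst moment_add) (auto intro!: continuous_intros uc q simp: moment_cmult[of c q] moment_cmult[of a "\<lambda>x. u x * q x"])
    finally show ?thesis .
  qed
  have nums: "k + 3 = Suc (k + 2)" "k + 2 = Suc (k + 1)" "k + 1 = Suc k" by simp_all
  note l = lin[OF continuous_dunkl_laplacian_hompoly[OF p], of "k + 2"] lin[OF hompoly_continuous[OF p], of "k + 1"]
    lin[OF hompoly_continuous[OF p], of k]
  have l1: "moment (\<lambda>x. (a * u x + c) * dunkl_laplacian Rp \<kappa> p x) (k + 3) s =
      a * moment (\<lambda>x. u x * dunkl_laplacian Rp \<kappa> p x) (k + 3) s + c * moment (\<lambda>x. 1 * dunkl_laplacian Rp \<kappa> p x) (k + 3) s"
   and l2: "moment (\<lambda>x. (a * u x + c) * p x) (k + 2) s = a * moment (\<lambda>x. u x * p x) (k + 2) s + c * moment (\<lambda>x. 1 * p x) (k + 2) s"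
   and l3: "moment (\<lambda>x. (a * u x + c) * p x) (k + 1) s = a * moment (\<lambda>x. u x * p x) (k + 1) s + c * moment (\<lambda>x. 1 * p x) (k + 1) s"
    using l by (simp_all add: numeral_3_eq_3)
  have e1: "moment (\<lambda>x. u x * dunkl_laplacian Rp \<kappa> p x) (k + 3) s
     - 2 * real (k + 3) * (homogeneous_dim + 2 * real m + 2 * real (k + 2)) * moment (\<lambda>x. u x * p x) (k + 2) s
     + 4 * real (k + 3) * real (k + 2) * s * moment (\<lambda>x. u x * p x) (k + 1) s = 0"
    using u p s by (auto simp: weakly_harmonic_def)
  have e2: "moment (\<lambda>x. 1 * dunkl_laplacian Rp \<kappa> p x) (k + 3) s
     - 2 * real (k + 3) * (homogeneous_dim + 2 * real m + 2 * real (k + 2)) * moment (\<lambda>x. 1 * p x) (k + 2) s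
     + 4 * real (k + 3) * real (k + 2) * s * moment (\<lambda>x. 1 * p x) (k + 1) s = 0"
    using weakly_harmonic_1 p s by (simp only: weakly_harmonic_def)
  show "moment (\<lambda>x. (a * u x + c) * dunkl_laplacian Rp \<kappa> p x) (k + 3) s
     - 2 * real (k + 3) * (homogeneous_dim + 2 * real m + 2 * real (k + 2)) * moment (\<lambda>x. (a * u x + c) * p x) (k + 2) s
     + 4 * real (k + 3) * real (k + 2) * s * moment (\<lambda>x. (a * u x + c) * p x) (k + 1) s = 0"
    unfolding l1 l2 l3 using e1 e2 by algebra
qed

lemma weakly_harmonic_moment_powr:
  assumes u: "weakly_harmonic u" and p: "hompoly m p"
    and lap: "\<And>s. s > 0 \<Longrightarrow> moment (\<lambda>x. u x * dunkl_laplacian Rp \<kappa> p x) (k + 3) s = 0"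
  shows "\<exists>C. \<forall>s>0. moment (\<lambda>x. u x * p x) (k + 2) s = C * s powr (homogeneous_dim / 2 + real m + real (k + 2))"
proof (rule moment_eq_powr)
  show "continuous_on UNIV (\<lambda>x. u x * p x)"
    using u by (auto simp: weakly_harmonic_def intro!: continuous_intros hompoly_continuous[OF p])
  fix s :: real assume s: "s > 0"
  have "moment (\<lambda>x. u x * dunkl_laplacian Rp \<kappa> p x) (k + 3) s
     - 2 * real (k + 3) * (homogeneous_dim + 2 * real m + 2 * real (k + 2)) * moment (\<lambda>x. u x * p x) (k + 2) s
     + 4 * real (k + 3) * real (k + 2) * s * moment (\<lambda>x. u x * p x) (k + 1) s = 0"
    using u p s by (simp only: weakly_harmonic_def)
  then have "4 * real (k + 3) * ((homogeneous_dim / 2 + real m + real (k + 2)) * moment (\<lambda>x. u x * p x) (k + 2) s)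
     = 4 * real (k + 3) * (real (k + 2) * s * moment (\<lambda>x. u x * p x) (k + 1) s)"
    unfolding lap[OF s] by (simp add: algebra_simps)
  then show "(homogeneous_dim / 2 + real m + real (k + 2)) * moment (\<lambda>x. u x * p x) (k + 2) s
     = real (k + 2) * s * moment (\<lambda>x. u x * p x) (k + 1) s"
    by (subst (asm) mult_cancel_left) auto
qed

text \<open>The weighted volume of a ball, in effect; constants being harmonic replaces a scaling argument.\<close>
lemma moment_1_powr: "\<exists>C\<ge>0. \<forall>s>0. moment (\<lambda>x. 1) (k + 2) s = C * s powr (homogeneous_dim / 2 + real (k + 2))"
proof -
  have "\<exists>C. \<forall>s>0. moment (\<lambda>x. 1 * 1) (k + 2) s = C * s powr (homogeneous_dim / 2 + real 0 + real (k + 2))"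
    by (rule weakly_harmonic_moment_powr[OF weakly_harmonic_1 hompoly.const])
      (simp add: dunkl_laplacian_const moment_def)
  then obtain C where C: "\<And>s. s > 0 \<Longrightarrow> moment (\<lambda>x. 1) (k + 2) s = C * s powr (homogeneous_dim / 2 + real (k + 2))" by auto
  have "moment (\<lambda>x. 1) (k + 2) 1 \<ge> 0"
    unfolding moment_def by (simp add: bump_nonneg weight_nonneg)
  then show ?thesis using C[of 1] C by auto
qed

text \<open>Induction on the degree. The induction hypothesis disposes of the Dunkl Laplacian of \<open>p\<close>, so the moment
  is \<open>C\<close> times a power of \<open>s\<close>. In degree \<open>0\<close>, letting \<open>s\<close> tend to \<open>0\<close> gives \<open>C = 0\<close>, which is the mean value
  property. In positive degree the mean value property bounds the moment of \<open>\<bar>u\<bar>\<close>, and letting \<open>s\<close> tend to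
  infinity gives \<open>C = 0\<close>.\<close>
lemma moment_eq_0:
  assumes h: "weakly_harmonic h" and nonneg: "\<And>x. h x \<ge> 0" and p: "hompoly m p" and s: "s > 0"
  shows "moment (\<lambda>x. (h x - h 0) * p x) (k + 2) s = 0"
  using p s
proof (induction m arbitrary: p k s rule: less_induct)
  case (less m)
  define u where "u x = h x - h 0" for x
  have hc: "continuous_on UNIV h" using h by (simp add: weakly_harmonic_def)
  have u: "weakly_harmonic u"
    using weakly_harmonic_affine[OF h, of 1 "- h 0"] by (simp add: u_def[abs_def])
  then have uc: "continuous_on UNIV u" by (simp add: weakly_harmonic_def)
  have IH: "moment (\<lambda>x. u x * q x) (l + 2) t = 0" if "i < m" "hompoly i q" "t > 0" for i q l t
    using less.IH[OF that] by (simp add: u_def)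
  have pc: "continuous_on UNIV p" using less.prems hompoly_continuous by blast
  have "moment (\<lambda>x. u x * dunkl_laplacian Rp \<kappa> p x) (k + 3) t = 0" if "t > 0" for t
  proof (cases m)
    case 0
    then show ?thesis using hompoly_dunkl_laplacian_0 less.prems by (simp add: moment_def)
  next
    case (Suc i)
    then obtain l where "l < m" "hompoly l (dunkl_laplacian Rp \<kappa> p)"
      using hompoly_dunkl_laplacian_Suc[of i p] less.prems by (auto simp: less_Suc_eq_le)
    then show ?thesis using IH[of l _ t "k + 1"] that by (simp add: numeral_3_eq_3)
  qed
  from weakly_harmonic_moment_powr[OF u less.prems(1) this]
  obtain C where C: "\<And>t. t > 0 \<Longrightarrow> moment (\<lambda>x. u x * p x) (k + 2) t = C * t powr (homogeneous_dim / 2 + real m + real (k + 2))"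
    by blast
  obtain C1 where C1: "C1 \<ge> 0" "\<And>t. t > 0 \<Longrightarrow> moment (\<lambda>x. 1) (k + 2) t = C1 * t powr (homogeneous_dim / 2 + real (k + 2))"
    using moment_1_powr by blast
  obtain K where K: "K \<ge> 0" "\<And>x. \<bar>p x\<bar> \<le> K * norm x ^ m"
    using hompoly_bound[OF less.prems(1)] by blast
  have upc: "continuous_on UNIV (\<lambda>x. u x * p x)" by (intro continuous_intros uc pc)
  have "C = 0"
  proof (cases m)
    case 0
    have "\<bar>C\<bar> \<le> 0 + e" if e: "e > 0" for e :: real
    proof -
      (* The summand 1 only guards against a vanishing denominator. *)
      define e' where "e' = e / (K * C1 + 1)"
      have e': "e' > 0" using e K C1 by (simp add: e'_def add_nonneg_pos)
      have "isCont u 0" using uc by (simp add: continuous_on_eq_continuous_at)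
      then obtain d where d: "d > 0" "\<And>x. norm x < d \<Longrightarrow> \<bar>u x\<bar> < e'"
        using e' unfolding continuous_at_eps_delta by (auto simp: u_def dist_norm)
      define t where "t = (d / 2)\<^sup>2"
      have t: "t > 0" "sqrt t = d / 2" using d by (auto simp: t_def)
      have "\<bar>moment (\<lambda>x. u x * p x) (Suc (k + 1)) t\<bar> \<le> moment (\<lambda>x. (e' * K) * 1) (Suc (k + 1)) t"
      proof (rule moment_abs_le[OF upc])
        fix x :: "real^'n" assume "norm x \<le> sqrt t"
        then have "\<bar>u x\<bar> \<le> e'" using d t by (intro less_imp_le d(2)) auto
        then show "\<bar>u x * p x\<bar> \<le> (e' * K) * 1"
          using K(2)[of x] e' K(1) 0 by (simp add: abs_mult mult_mono)
      qed (use t in auto)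
      then have "\<bar>C\<bar> * t powr (homogeneous_dim / 2 + real (k + 2)) \<le> (e' * K * C1) * t powr (homogeneous_dim / 2 + real (k + 2))"
        unfolding moment_cmult using C[OF t(1)] C1(2)[OF t(1)] 0 by (simp add: abs_mult mult_ac)
      then have "\<bar>C\<bar> \<le> e' * K * C1"
        by (rule mult_right_le_imp_le) (use t in simp)
      also have "\<dots> \<le> e" 
      proof -
        have pos: "K * C1 + 1 > 0" using K C1 by (simp add: add_nonneg_pos)
        have "e' * K * C1 \<le> e' * (K * C1 + 1)" using e' by (simp add: algebra_simps)
        also have "\<dots> = e" using pos by (simp add: e'_def)
        finally show ?thesis .
      qed
      finally show ?thesis by simp
    qed
    then have "\<bar>C\<bar> \<le> 0" by (rule field_le_epsilon)
    then show ?thesis by simp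
  next
    case (Suc i)
    (* Both sides of the growth comparison at s = r^2, after division by r^m and the volume factor. *)
    have bound: "\<bar>C\<bar> * r ^ m \<le> 2 * K * h 0 * C1" if r: "r > 0" for r
    proof -
      define t where "t = r\<^sup>2"
      have t: "t > 0" "sqrt t = r" using r by (auto simp: t_def)
      have "\<bar>moment (\<lambda>x. u x * p x) (Suc (k + 1)) t\<bar> \<le> moment (\<lambda>x. (K * r ^ m) * (u x * 1 + (2 * h 0) * 1)) (Suc (k + 1)) t"
      proof (rule moment_abs_le[OF upc])
        fix x :: "real^'n" assume x: "norm x \<le> sqrt t"
        have "\<bar>u x\<bar> \<le> u x * 1 + (2 * h 0) * 1" using nonneg[of x] nonneg[of 0] by (simp add: u_def)
        moreover have "\<bar>p x\<bar> \<le> K * r ^ m"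
          using K(2)[of x] power_mono[of "norm x" r m] x t K(1) by (meson mult_left_mono norm_ge_zero order_trans)
        ultimately show "\<bar>u x * p x\<bar> \<le> (K * r ^ m) * (u x * 1 + (2 * h 0) * 1)"
          unfolding abs_mult using mult_mono[of "\<bar>p x\<bar>" "K * r ^ m" "\<bar>u x\<bar>" "u x * 1 + 2 * h 0 * 1"] K(1) r
          by (simp add: mult.commute)
      next
        show "continuous_on UNIV (\<lambda>x. (K * r ^ m) * (u x * 1 + (2 * h 0) * 1))"
          by (intro continuous_intros uc)
      qed (use t in auto)
      also have "\<dots> = (K * r ^ m) * (moment (\<lambda>x. u x * 1) (Suc (k + 1)) t + (2 * h 0) * moment (\<lambda>x. 1) (Suc (k + 1)) t)"
        unfolding moment_cmult by (subst moment_add) (auto intro!: continuous_intros uc simp only: moment_cmult)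
      also have "moment (\<lambda>x. u x * 1) (Suc (k + 1)) t = 0"
        using IH[OF _ hompoly.const t(1), of 1 k] Suc by simp
      finally have le: "\<bar>moment (\<lambda>x. u x * p x) (k + 2) t\<bar> \<le> (K * r ^ m) * ((2 * h 0) * moment (\<lambda>x. 1) (k + 2) t)"
        by simp
      have "t powr (homogeneous_dim / 2 + real m + real (k + 2)) = t powr real m * t powr (homogeneous_dim / 2 + real (k + 2))"
        by (simp add: powr_add)
      also have "t powr real m = r ^ m * r ^ m"
        using t(1) by (simp add: powr_realpow t_def power_mult_distrib power2_eq_square)
      finally have pw: "t powr (homogeneous_dim / 2 + real m + real (k + 2)) = r ^ m * r ^ m * t powr (homogeneous_dim / 2 + real (k + 2))" .
      have pos: "r ^ m * t powr (homogeneous_dim / 2 + real (k + 2)) > 0" using r t by simp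
      have "(\<bar>C\<bar> * r ^ m) * (r ^ m * t powr (homogeneous_dim / 2 + real (k + 2))) \<le> (2 * K * h 0 * C1) * (r ^ m * t powr (homogeneous_dim / 2 + real (k + 2)))"
        using le unfolding C[OF t(1)] C1(2)[OF t(1)] pw using r by (simp add: abs_mult mult_ac)
      then show ?thesis by (rule mult_right_le_imp_le[OF _ pos])
    qed
    show ?thesis
    proof (rule ccontr)
      assume "C \<noteq> 0"
      define D where "D = 2 * K * h 0 * C1"
      have D: "D \<ge> 0" using K C1 nonneg[of 0] by (simp add: D_def)
      define r where "r = (D + 1) / \<bar>C\<bar> + 1"
      have r: "r \<ge> 1" using D by (simp add: r_def)
      have "\<bar>C\<bar> * r = D + 1 + \<bar>C\<bar>" using \<open>C \<noteq> 0\<close> by (simp add: r_def field_simps)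
      then have "D < \<bar>C\<bar> * r" by simp
      also have "\<bar>C\<bar> * r \<le> \<bar>C\<bar> * r ^ m"
        using r Suc by (intro mult_left_mono self_le_power) auto
      also have "\<dots> \<le> D" unfolding D_def using r by (intro bound) auto
      finally show False by simp
    qed
  qed
  then show ?case using C[OF less.prems(2)] by (simp add: u_def)
qed

text \<open>All moments of \<open>u = h - h 0\<close> against polynomials vanish, hence by uniform approximation
  of \<open>u\<close> on a ball also the moment of \<open>u\<^sup>2\<close>.\<close>
lemma nonneg_weakly_harmonic_const:
  assumes h: "weakly_harmonic h" and nonneg: "\<And>x. h x \<ge> 0"
  shows "h x = h 0"
proof -
  define u where "u x = h x - h 0" for x
  have hc: "continuous_on UNIV h" using h by (simp add: weakly_harmonic_def)
  then have uc: "continuous_on UNIV u" unfolding u_def[abs_def] by (intro continuous_intros)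
  define s where "s = x \<bullet> x + 1"
  have s: "s > 0" by (simp add: s_def add_nonneg_pos)
  have poly: "continuous_on UNIV q \<and> moment (\<lambda>x. u x * q x) (Suc 1) s = 0" if "real_polynomial_function q" for q
  proof (rule real_polynomial_function_hompoly_sum[OF that])
    show "continuous_on UNIV q \<and> moment (\<lambda>x. u x * q x) (Suc 1) s = 0" if "hompoly m q" for m q
      using moment_eq_0[OF h nonneg that s, of 0] hompoly_continuous[OF that] by (simp add: u_def numeral_2_eq_2)
  next
    fix f g :: "real^'n \<Rightarrow> real"
    assume fg: "continuous_on UNIV f \<and> moment (\<lambda>x. u x * f x) (Suc 1) s = 0"
      "continuous_on UNIV g \<and> moment (\<lambda>x. u x * g x) (Suc 1) s = 0"
    have "moment (\<lambda>x. u x * f x + u x * g x) (Suc 1) s = 0"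
      by (subst moment_add) (use fg in \<open>auto intro!: continuous_intros uc\<close>)
    then show "continuous_on UNIV (\<lambda>x. f x + g x) \<and> moment (\<lambda>x. u x * (f x + g x)) (Suc 1) s = 0"
      using fg by (auto simp: distrib_left intro!: continuous_intros)
  qed
  let ?M = "moment (\<lambda>x. u x * u x) (Suc 1) s"
  have "?M \<le> 0 + e" if e: "e > 0" for e
  proof -
    define A where "A = moment (\<lambda>x. \<bar>u x\<bar>) (Suc 1) s"
    have A: "A \<ge> 0" unfolding A_def moment_def by (simp add: bump_nonneg weight_nonneg)
    define d where "d = e / (A + 1)"
    have d: "d > 0" using e A by (simp add: d_def)
    obtain q where q: "real_polynomial_function q" "\<And>x. x \<in> cball 0 (sqrt s) \<Longrightarrow> \<bar>u x - q x\<bar> < d"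
      using Stone_Weierstrass_real_polynomial_function[OF compact_cball continuous_on_subset[OF uc subset_UNIV] d, of 0 "sqrt s"]
      by metis
    note qq = poly[OF q(1)]
    have "?M = moment (\<lambda>x. u x * (u x - q x) + u x * q x) (Suc 1) s"
      by (simp add: algebra_simps)
    also have "\<dots> = moment (\<lambda>x. u x * (u x - q x)) (Suc 1) s"
      by (subst moment_add) (use qq in \<open>auto intro!: continuous_intros uc\<close>)
    also have "\<dots> \<le> \<bar>moment (\<lambda>x. u x * (u x - q x)) (Suc 1) s\<bar>" by simp
    also have "\<dots> \<le> moment (\<lambda>x. d * \<bar>u x\<bar>) (Suc 1) s"
    proof (rule moment_abs_le)
      fix x :: "real^'n" assume "norm x \<le> sqrt s"
      then have "\<bar>u x - q x\<bar> \<le> d" using q(2)[of x] by auto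
      then show "\<bar>u x * (u x - q x)\<bar> \<le> d * \<bar>u x\<bar>"
        by (simp add: abs_mult mult_left_mono mult.commute[of d])
    qed (use s qq in \<open>auto intro!: continuous_intros uc\<close>)
    also have "\<dots> = d * A" by (simp add: moment_cmult A_def)
    also have "\<dots> \<le> e" using e A by (simp add: d_def field_simps)
    finally show ?thesis by simp
  qed
  then have "?M \<le> 0" by (rule field_le_epsilon)
  moreover have "?M \<ge> 0" unfolding moment_def by (simp add: bump_nonneg weight_nonneg)
  ultimately have M0: "?M = 0" by simp
  have "continuous_on UNIV (\<lambda>x. u x * u x)" by (intro continuous_intros uc)
  note int = integrable_moment[OF this]
  have "u x * u x * bump (Suc 1) s x * weight 0 x = 0" for x
    using M0 unfolding moment_def
    by (intro continuous_nonneg_integral_0_imp_0[OF continuous_moment_integrand int])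
       (auto simp: bump_nonneg weight_nonneg intro!: continuous_intros uc)
  (* The weight vanishes on the mirrors; these are null, so a second appeal to continuity removes it. *)
  then have van: "u x * u x * bump (Suc 1) s x = 0" if "\<And>v. v \<in> R \<Longrightarrow> x \<bullet> v \<noteq> 0" for x
    using weight_pos[of x] that by (metis less_irrefl mult_eq_0_iff)
  have c: "continuous_on UNIV (\<lambda>x. u x * u x * bump (Suc 1) s x)"
    by (intro continuous_intros uc continuous_bump)
  have "AE x in lborel. \<forall>v\<in>R. x \<bullet> v \<noteq> 0"
    by (intro AE_finite_allI finite_R AE_inner_neq_0 nonzero)
  then have "AE x in lborel. u x * u x * bump (Suc 1) s x = 0"
    by eventually_elim (rule van, auto)
  then have I0: "(\<integral>x. u x * u x * bump (Suc 1) s x \<partial>lborel) = 0"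
    by (rule integral_eq_zero_AE)
  have "u x * u x * bump (Suc 1) s x = 0"
  proof (rule continuous_nonneg_integral_0_imp_0[OF c _ _ I0])
    show "integrable lborel (\<lambda>x. u x * u x * bump (Suc 1) s x)"
    proof (rule integrable_compact_support[OF c, of "sqrt s"])
      show "u x * u x * bump (Suc 1) s x = 0" if "norm x > sqrt s" for x
        using bump_eq_0[of s "sqrt s" x 1] that s by simp
    qed
  qed (auto simp: bump_nonneg)
  moreover have "bump (Suc 1) s x = 1" by (simp add: bump_def s_def)
  ultimately show ?thesis by (simp add: u_def)
qed

end

theorem mainTheorem2:
  fixes R Rp :: "(real^'n) set"
    and \<kappa> :: "real^'n \<Rightarrow> real"
    and f :: "real^'n \<Rightarrow> real"
  assumes "root_system R"
    and "positive_subsystem R Rp"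
    and "multiplicity_function R \<kappa>"
    and "\<forall>v\<in>R. \<kappa> v \<ge> 0"
    and "C2 f"
    and "\<forall>x. dunkl_laplacian Rp \<kappa> f x = 0"
    and "bdd_above (range f) \<or> bdd_below (range f)"
  shows "f constant_on UNIV"
proof -
  interpret dunkl R Rp \<kappa>
    using assms(1-4) by unfold_locales auto
  have wh: "weakly_harmonic f"
    using assms(5,6) by (intro harmonic_imp_weakly_harmonic) auto
  have "\<exists>a c. a \<noteq> 0 \<and> (\<forall>x. a * f x + c \<ge> 0)"
    using assms(7)
  proof
    assume "bdd_above (range f)"
    then obtain M where "\<And>x. f x \<le> M" by (auto simp: bdd_above_def)
    then show ?thesis by (intro exI[of _ "-1"] exI[of _ M]) auto
  next
    assume "bdd_below (range f)"
    then obtain M where "\<And>x. M \<le> f x" by (auto simp: bdd_below_def)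
    then show ?thesis by (intro exI[of _ 1] exI[of _ "-M"]) auto
  qed
  then obtain a c where ac: "a \<noteq> 0" "\<And>x. a * f x + c \<ge> 0" by blast
  have "a * f x + c = a * f 0 + c" for x
    by (rule nonneg_weakly_harmonic_const[OF weakly_harmonic_affine[OF wh] ac(2)])
  then have "f x = f 0" for x using ac(1) by simp
  then show ?thesis unfolding constant_on_def by blast
qed

end
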